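(* Let $n\ge2$ and let $\{(X_j,Y_j):j=1,\ldots,n\}$ follow the 2-exchangeable copula model with margins $F$ (density $f$) for the $X_j$ and $G$ (density $g$) for the $Y_j$, bivariate copula density $c^{(2)}$ and 1-exchangeable copula families $\{c^{(1)}_{1,1:n}\}$, $\{c^{(3)}_{1,1:n}\}$. Put $w_j=C_{2|1}\{G(y_j)|F(x_j)\}$, $j=1,\ldots,n-1$. Then the conditional density of $Y_n$ given $X_n=x_n$ and $(X_j,Y_j)=(x_j,y_j)$, $j=1,\ldots,n-1$, is $$g_P(y_n)=g(y_n)\,c^{(2)}\{F(x_n),G(y_n)\}\,\frac{c^{(3)}_{1,1:n}\big[w_1,\ldots,w_{n-1},C_{2|1}\{G(y_n)|F(x_n)\}\big]}{c^{(3)}_{1,1:(n-1)}(w_1,\ldots,w_{n-1})},$$ and the conditional expectation of $Y_n$ given the same variables (the best predictor of the unknown $Y_n$) can be expressed as $$\mathbb{E}_P(Y_n)=\int_0^1G^{-1}\big[C_{2|1}^{-1}\{w|F(x_n)\}\big]\frac{c^{(3)}_{1,1:n}(w_1,\ldots,w_{n-1},w)}{c^{(3)}_{1,1:(n-1)}(w_1,\ldots,w_{n-1})}\,dw.$$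
   Context: The 2-exchangeable copula model: $U_j=F(X_j)$ and $V_j=G(Y_j)$ have joint density $$c_{2,1:n}\{(u_1,v_1),\ldots,(u_n,v_n)\}=c^{(1)}_{1,1:n}(u_1,\ldots,u_n)\prod_{j=1}^n c^{(2)}(u_j,v_j)\; c^{(3)}_{1,1:n}\{C_{2|1}(v_1|u_1),\ldots,C_{2|1}(v_n|u_n)\},$$ where $c^{(2)}$ is the density of the bivariate copula $C^{(2)}$, $C_{2|1}(v|u)=\partial C^{(2)}(u,v)/\partial u$ is the conditional cdf of the second variable given the first, and $\{c^{(1)}_{1,1:n}\}$, $\{c^{(3)}_{1,1:n}\}$ are families of 1-exchangeable copula densities, i.e. $n$-variate copula densities of permutation-invariant distributions such that for $r\le n$ the $r$-variate margin of $c_{1,1:n}$ is $c_{1,1:r}$ (so $c_{1,1:1}\equiv1$, the uniform density). $G^{-1}$ is the inverse (quantile function) of $G$ and $C_{2|1}^{-1}(\cdot|u)$ is the inverse of the cdf $v\mapsto C_{2|1}(v|u)$. *)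

theory Defs
  imports "HOL-Probability.Probability"
begin

abbreviation unif01 :: "real measure" where
  "unif01 \<equiv> uniform_measure lborel {0..1}"

text \<open>
  Copula densities are densities with respect to Lebesgue measure on the unit cube, i.e. with
  respect to a product of copies of \<^const>\<open>uniform_measure\<close>; their values off the cube are
  irrelevant. Points of the \<open>m\<close>-dimensional cube are extensional functions on \<open>{1..m}\<close>.
\<close>

definition copula_law :: "nat \<Rightarrow> ((nat \<Rightarrow> real) \<Rightarrow> real) \<Rightarrow> (nat \<Rightarrow> real) measure" where
  "copula_law m c = density (\<Pi>\<^sub>M j\<in>{1..m}. unif01) (\<lambda>x. ennreal (c x))"

definition copula_density :: "nat \<Rightarrow> ((nat \<Rightarrow> real) \<Rightarrow> real) \<Rightarrow> bool" where
  "copula_density m c \<longleftrightarrow>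
     c \<in> borel_measurable (\<Pi>\<^sub>M j\<in>{1..m}. borel) \<and>
     (\<forall>x. 0 \<le> c x) \<and>
     (\<forall>j\<in>{1..m}. distr (copula_law m c) borel (\<lambda>x. x j) = unif01)"

definition exchangeable_copula_family :: "(nat \<Rightarrow> (nat \<Rightarrow> real) \<Rightarrow> real) \<Rightarrow> bool" where
  "exchangeable_copula_family c \<longleftrightarrow>
     (\<forall>m\<ge>1. copula_density m (c m) \<and>
        (\<forall>\<pi>. \<pi> permutes {1..m} \<longrightarrow>
           distr (copula_law m (c m)) (\<Pi>\<^sub>M j\<in>{1..m}. borel) (\<lambda>x. \<lambda>j\<in>{1..m}. x (\<pi> j))
             = copula_law m (c m)) \<and>
        (\<forall>r\<in>{1..m}.
           distr (copula_law m (c m)) (\<Pi>\<^sub>M j\<in>{1..r}. borel) (\<lambda>x. restrict x {1..r})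
             = copula_law r (c r)))"

definition copula2_law :: "(real \<Rightarrow> real \<Rightarrow> real) \<Rightarrow> (real \<times> real) measure" where
  "copula2_law c = density (unif01 \<Otimes>\<^sub>M unif01) (\<lambda>(u, v). ennreal (c u v))"

definition copula2_density :: "(real \<Rightarrow> real \<Rightarrow> real) \<Rightarrow> bool" where
  "copula2_density c \<longleftrightarrow>
     (\<lambda>(u, v). c u v) \<in> borel_measurable (borel \<Otimes>\<^sub>M borel) \<and>
     (\<forall>u v. 0 \<le> c u v) \<and>
     distr (copula2_law c) borel fst = unif01 \<and>
     distr (copula2_law c) borel snd = unif01"

definition copula2_cdf :: "(real \<Rightarrow> real \<Rightarrow> real) \<Rightarrow> real \<Rightarrow> real \<Rightarrow> real" where
  "copula2_cdf c u v = measure (copula2_law c) ({..u} \<times> {..v})"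

text \<open>
  \<open>copula2_cond_cdf c v u\<close> is $C_{2|1}(v|u) = \partial C(u,v)/\partial u$. For almost every \<open>u\<close> in
  the unit interval the derivative exists for all \<open>v\<close>; at the remaining \<open>u\<close> the value is
  arbitrary.
\<close>

definition copula2_cond_cdf :: "(real \<Rightarrow> real \<Rightarrow> real) \<Rightarrow> real \<Rightarrow> real \<Rightarrow> real" where
  "copula2_cond_cdf c v u = deriv (\<lambda>t. copula2_cdf c t v) u"

text \<open>The generalised inverse of a cdf; arguments \<open>p\<close> outside the open unit interval are junk.\<close>

definition quantile :: "(real \<Rightarrow> real) \<Rightarrow> real \<Rightarrow> real" where
  "quantile H p = Inf {x. p \<le> H x}"

definition exch2_copula_density ::
  "nat \<Rightarrow> (nat \<Rightarrow> (nat \<Rightarrow> real) \<Rightarrow> real) \<Rightarrow> (real \<Rightarrow> real \<Rightarrow> real) \<Rightarrow>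
   (nat \<Rightarrow> (nat \<Rightarrow> real) \<Rightarrow> real) \<Rightarrow> (nat \<Rightarrow> real \<times> real) \<Rightarrow> real" where
  "exch2_copula_density n c1 c2 c3 p =
     c1 n (\<lambda>j\<in>{1..n}. fst (p j)) *
     (\<Prod>j=1..n. c2 (fst (p j)) (snd (p j))) *
     c3 n (\<lambda>j\<in>{1..n}. copula2_cond_cdf c2 (snd (p j)) (fst (p j)))"

definition exch2_copula_model ::
  "'w measure \<Rightarrow> nat \<Rightarrow> (nat \<Rightarrow> 'w \<Rightarrow> real) \<Rightarrow> (nat \<Rightarrow> 'w \<Rightarrow> real) \<Rightarrow>
   (real \<Rightarrow> real) \<Rightarrow> (real \<Rightarrow> real) \<Rightarrow> (real \<Rightarrow> real) \<Rightarrow> (real \<Rightarrow> real) \<Rightarrow>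
   (nat \<Rightarrow> (nat \<Rightarrow> real) \<Rightarrow> real) \<Rightarrow> (real \<Rightarrow> real \<Rightarrow> real) \<Rightarrow>
   (nat \<Rightarrow> (nat \<Rightarrow> real) \<Rightarrow> real) \<Rightarrow> bool" where
  "exch2_copula_model M n X Y F f G g c1 c2 c3 \<longleftrightarrow>
     prob_space M \<and>
     (\<forall>x. 0 \<le> f x) \<and> (\<forall>y. 0 \<le> g y) \<and>
     (\<forall>j\<in>{1..n}. distributed M lborel (X j) (\<lambda>x. ennreal (f x)) \<and>
                  cdf (distr M borel (X j)) = F) \<and>
     (\<forall>j\<in>{1..n}. distributed M lborel (Y j) (\<lambda>y. ennreal (g y)) \<and>
                  cdf (distr M borel (Y j)) = G) \<and>
     exchangeable_copula_family c1 \<and> copula2_density c2 \<and> exchangeable_copula_family c3 \<and>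
     distributed M (\<Pi>\<^sub>M j\<in>{1..n}. unif01 \<Otimes>\<^sub>M unif01)
       (\<lambda>\<omega>. \<lambda>j\<in>{1..n}. (F (X j \<omega>), G (Y j \<omega>)))
       (\<lambda>p. ennreal (exch2_copula_density n c1 c2 c3 p))"

text \<open>
  \<open>h z\<close> is a (version of the) conditional Lebesgue density of the real random variable \<open>T\<close> given
  \<open>Z = z\<close>, where \<open>Z\<close> takes values in \<open>N\<close>: for almost every value of \<open>Z\<close> it is a probability density,
  and integrating it over \<open>B\<close> gives the conditional probability that \<open>T\<close> lies in \<open>B\<close>.
\<close>

definition conditional_density ::
  "'w measure \<Rightarrow> 'z measure \<Rightarrow> ('w \<Rightarrow> 'z) \<Rightarrow> ('w \<Rightarrow> real) \<Rightarrow> ('z \<Rightarrow> real \<Rightarrow> real) \<Rightarrow> bool" where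
  "conditional_density M N Z T h \<longleftrightarrow>
     (AE \<omega> in M. h (Z \<omega>) \<in> borel_measurable borel \<and> (\<forall>y. 0 \<le> h (Z \<omega>) y) \<and>
                 (\<integral>\<^sup>+ y. ennreal (h (Z \<omega>) y) \<partial>lborel) = 1) \<and>
     (\<forall>B\<in>sets borel. AE \<omega> in M.
        real_cond_exp M (vimage_algebra (space M) Z N) (\<lambda>\<omega>. indicator B (T \<omega>)) \<omega>
          = (LINT y:B|lborel. h (Z \<omega>) y))"

end

(* The laws of (X, Y) and of its copula coordinates (U, V) = (F(X), G(Y)) determine each other through
   the quantile functions, so everything is first done on the unit cube. There, for almost every u,
   v |-> C_{2|1}(v|u) is the cdf of the probability density c2(u, .); pushing this density forward
   along its own cdf gives the uniform law. Hence integrating c2(u_n, v) c3_n(w, C_{2|1}(v|u_n)) over v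
   gives the integral of c3_n(w, t) over t, which is c3_{n-1}(w) by the margin property, and the
   quotient in the theorem is the normalised conditional density. The formula for the expectation is
   the substitution t = C_{2|1}(G(y)|F(x_n)).

   The derivative defining C_{2|1} is handled by Lebesgue's differentiation theorem for bounded
   densities, obtained from the Vitali covering theorem. *)

theory Submission
  imports Defs
begin


section \<open>Lebesgue differentiation\<close>

text \<open>The obstacle throughout is null sets. A pointwise \<open>deriv\<close> carries no
  evident measurability and is meaningful only at almost every u. The proof therefore calculates
  with \<open>cdf (cond_law c u)\<close>, which is jointly measurable, and swaps it in on a set of
  full measure. The margin property of c3 is an equality of laws, so as an identity between
  densities it holds only for almost every w. Its exceptional set need not pull back to a
  Lebesgue-null set of copula coordinates, because v |-> C_{2|1}(v|u) is constant on intervals where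
  c2(u, .) vanishes. It does pull back to a null set for the product of the laws with density c2,
  under which the w_j are independent uniforms; at all other exceptional points some c2 factor is 0,
  and with it the joint density. Where c3_{n-1}(w) = 0 the quotient is junk, but there the joint
  density vanishes for almost every v_n, so the identity behind the quotient is stated with the
  denominator multiplied out. The factor c1 cancels because it does not contain v_n.\<close>

text \<open>Vitali argument: disjoint balls of \<nu>-mean at least q exhaust the set up to a null
  set, and they lie in an open G that exceeds A = {f < p} by little. For their union W this gives q
  |W| \<le> \<nu>(W) \<le> p |W| + |G - A|, which forces |W| \<le> e. The balls contain x but need
  not be centred there, so intervals with endpoint x are included. Restricting to
  \<open>ball 0 R\<close> keeps |W| finite, so that p |W| can be subtracted.\<close>

lemma negligible_upper_mean_gap:
  fixes f :: "real \<Rightarrow> real" and p q R :: real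
  assumes [measurable]: "f \<in> borel_measurable borel"
    and f: "\<And>x. 0 \<le> f x" "\<And>x. f x \<le> 1" and pq: "0 \<le> p" "p < q"
  shows "negligible {x \<in> ball 0 R. f x < p \<and>
    (\<forall>d>0. \<exists>a r. 0 < r \<and> r < d \<and> x \<in> cball a r \<and>
       ennreal (q * (2 * r)) \<le> emeasure (density lborel (\<lambda>s. ennreal (f s))) (cball a r))}"
    (is "negligible ?S")
  unfolding negligible_outer_le
proof (intro allI impI)
  fix e :: real assume e: "e > 0"
  define A where "A = {x \<in> ball 0 R. f x < p}"
  define \<nu> where "\<nu> = density lborel (\<lambda>s. ennreal (f s))"
  have sets_\<nu>[measurable_cong, simp]: "sets \<nu> = sets borel" by (simp add: \<nu>_def)
  have A[measurable]: "A \<in> sets borel" unfolding A_def by measurable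
  have "A \<in> sets lebesgue" by (simp add: sets_completionI_sets)
  \<comment> \<open>The tolerance is scaled so that the final division by q - p leaves exactly
    e.\<close>
  moreover have "(q - p) * e > 0" using e pq by simp
  ultimately obtain G0 where G0: "open G0" "A \<subseteq> G0" "emeasure lebesgue (G0 - A) < ennreal ((q - p) * e)"
    by (rule sets_lebesgue_outer_open)
  define G where "G = G0 \<inter> ball 0 R"
  have G: "open G" "A \<subseteq> G" using G0 by (auto simp: G_def A_def)
  then have [measurable]: "G \<in> sets borel" by simp
  have GA: "emeasure lborel (G - A) \<le> ennreal ((q - p) * e)"
  proof -
    have "emeasure lborel (G - A) = emeasure lebesgue (G - A)" by simp
    also have "\<dots> \<le> emeasure lebesgue (G0 - A)"
      using G0(1) by (intro emeasure_mono) (auto simp: G_def)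
    finally show ?thesis using G0(3) by simp
  qed
  define K where "K = {(a, r). 0 < r \<and> cball a r \<subseteq> G \<and> ennreal (q * (2 * r)) \<le> emeasure \<nu> (cball a r)}"
  have cov: "\<exists>i. i \<in> K \<and> x \<in> cball (fst i) (snd i) \<and> snd i < d" if "x \<in> ?S" "0 < d" for x d
  proof -
    have "x \<in> G" using that G by (auto simp: A_def)
    then obtain \<delta> where \<delta>: "\<delta> > 0" "ball x \<delta> \<subseteq> G" using G(1) open_contains_ball by blast
    have "min d (\<delta> / 2) > 0" using that \<delta> by simp
    moreover have "\<forall>d>0. \<exists>a r. 0 < r \<and> r < d \<and> x \<in> cball a r \<and>
       ennreal (q * (2 * r)) \<le> emeasure \<nu> (cball a r)" using that(1) by (simp add: \<nu>_def)
    ultimately obtain a r where ar: "0 < r" "r < min d (\<delta> / 2)" "x \<in> cball a r"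
       "ennreal (q * (2 * r)) \<le> emeasure \<nu> (cball a r)" by blast
    have "cball a r \<subseteq> ball x \<delta>"
    proof
      fix y assume "y \<in> cball a r"
      then have "dist x y \<le> r + r" using ar(3) by (simp add: dist_real_def)
      then show "y \<in> ball x \<delta>" using ar(2) by simp
    qed
    then show ?thesis using ar \<delta> unfolding K_def by (intro exI[of _ "(a, r)"]) auto
  qed
  obtain C where C: "countable C" "C \<subseteq> K"
     "pairwise (\<lambda>i j. disjnt (cball (fst i) (snd i)) (cball (fst j) (snd j))) C"
     and neg: "negligible (?S - (\<Union>i \<in> C. cball (fst i) (snd i)))"
  proof (rule Vitali_covering_theorem_cballs[of K snd ?S fst])
    show "0 < snd i" if "i \<in> K" for i using that by (auto simp: K_def)
  qed (use cov in \<open>assumption | blast\<close>)+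
  define W where "W = (\<Union>i \<in> C. cball (fst i) (snd i))"
  have [measurable]: "W \<in> sets borel" unfolding W_def using C(1) by (intro sets.countable_UN') auto
  have WG: "W \<subseteq> G" unfolding W_def
  proof (rule UN_least)
    fix i assume "i \<in> C"
    then have "i \<in> K" using C(2) by blast
    then show "cball (fst i) (snd i) \<subseteq> G" by (auto simp: K_def)
  qed
  have "emeasure lborel W \<le> emeasure lborel (ball (0::real) R)"
    using WG by (intro emeasure_mono) (auto simp: G_def)
  then have Wfin: "emeasure lborel W < \<infinity>"
    using emeasure_bounded_finite[of "ball (0::real) R"] by (auto simp: less_top[symmetric] top_unique)
  have disj: "disjoint_family_on (\<lambda>i. cball (fst i) (snd i)) C"
    using C(3) by (auto simp: disjoint_family_on_def pairwise_def disjnt_def)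
  have "ennreal q * emeasure lborel W = (\<integral>\<^sup>+i. ennreal q * emeasure lborel (cball (fst i) (snd i)) \<partial>count_space C)"
    unfolding W_def using C(1) disj
    by (subst emeasure_UN_countable) (auto intro!: nn_integral_cmult[symmetric])
  also have "\<dots> \<le> (\<integral>\<^sup>+i. emeasure \<nu> (cball (fst i) (snd i)) \<partial>count_space C)"
  proof (intro nn_integral_mono)
    fix i assume "i \<in> space (count_space C)"
    then have i: "0 < snd i" "ennreal (q * (2 * snd i)) \<le> emeasure \<nu> (cball (fst i) (snd i))"
      using C(2) by (auto simp: K_def)
    then show "ennreal q * emeasure lborel (cball (fst i) (snd i)) \<le> emeasure \<nu> (cball (fst i) (snd i))"
      using pq by (simp add: cball_eq_atLeastAtMost ennreal_mult[symmetric])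
  qed
  also have "\<dots> = emeasure \<nu> W"
    unfolding W_def using C(1) disj by (subst emeasure_UN_countable) auto
  also have "\<dots> = (\<integral>\<^sup>+s\<in>W. ennreal (f s) \<partial>lborel)"
    unfolding \<nu>_def by (subst emeasure_density) auto
  also have "\<dots> \<le> (\<integral>\<^sup>+s. ennreal p * indicator W s + indicator (G - A) s \<partial>lborel)"
  proof (intro nn_integral_mono)
    fix s
    consider "s \<notin> W" | "s \<in> W" "s \<in> A" | "s \<in> W" "s \<in> G - A" using WG by blast
    then show "ennreal (f s) * indicator W s \<le> ennreal p * indicator W s + indicator (G - A) s"
    proof cases
      case 2
      then have "f s \<le> p" by (simp add: A_def)
      then show ?thesis using 2 by (simp add: ennreal_leI)
    next
      case 3
      have "ennreal (f s) \<le> 1" using f(2) by (simp add: ennreal_le_1)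
      then show ?thesis using 3 by (simp add: add_increasing)
    qed simp
  qed
  also have "\<dots> = ennreal p * emeasure lborel W + emeasure lborel (G - A)"
    by (subst nn_integral_add) (auto simp: nn_integral_cmult)
  also have "\<dots> \<le> ennreal p * emeasure lborel W + ennreal ((q - p) * e)"
    using GA by (intro add_left_mono) auto
  finally have "ennreal q * emeasure lborel W \<le> ennreal p * emeasure lborel W + ennreal ((q - p) * e)" .
  moreover have mW: "emeasure lborel W = ennreal (measure lborel W)"
    using Wfin by (intro emeasure_eq_ennreal_measure) auto
  ultimately have "q * measure lborel W \<le> p * measure lborel W + (q - p) * e"
    using pq e by (simp add: ennreal_mult[symmetric] ennreal_plus[symmetric] del: ennreal_plus)
  then have "(q - p) * measure lborel W \<le> (q - p) * e" by (simp add: algebra_simps)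
  then have le: "measure lborel W \<le> e" using pq by simp
  let ?N = "?S - W"
  have N: "negligible ?N" using neg by (simp add: W_def)
  have Wl: "W \<in> lmeasurable" using Wfin by (intro fmeasurableI) (auto)
  show "\<exists>T. ?S \<subseteq> T \<and> T \<in> lmeasurable \<and> measure lebesgue T \<le> e"
  proof (intro exI[of _ "W \<union> ?N"] conjI)
    show "W \<union> ?N \<in> lmeasurable" by (intro fmeasurable.Un Wl negligible_imp_measurable N)
    have "measure lebesgue (W \<union> ?N) \<le> measure lebesgue W + measure lebesgue ?N"
      by (intro measure_Un_le fmeasurableD Wl negligible_imp_measurable N)
    then show "measure lebesgue (W \<union> ?N) \<le> e"
      using le N by (simp add: negligible_imp_measure0)
  qed auto
qed


lemma set_integrable_bounded_cball:
  fixes f :: "real \<Rightarrow> real"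
  assumes [measurable]: "f \<in> borel_measurable borel" and f: "\<And>x. 0 \<le> f x" "\<And>x. f x \<le> 1"
  shows "set_integrable lborel (cball a r) f"
  unfolding set_integrable_def
proof (rule integrableI_bounded_set[where A="cball a r" and B=1])
  show "emeasure lborel (cball a r) < \<infinity>"
    using emeasure_bounded_finite[of "cball a r"] by auto
qed (use f in \<open>auto simp: indicator_def\<close>)

text \<open>Countably many exceptional sets suffice: if arbitrarily small balls around x have mean
  at least f x + e, then rationals f x < p < q < f x + e and an integer radius put x into one of the
  null sets \<open>S p q R\<close>.\<close>

lemma AE_upper_mean_le:
  fixes f :: "real \<Rightarrow> real"
  assumes [measurable]: "f \<in> borel_measurable borel" and f: "\<And>x. 0 \<le> f x" "\<And>x. f x \<le> 1"
  shows "AE x in lborel. \<forall>e>0. \<exists>d>0. \<forall>a r. 0 < r \<longrightarrow> r < d \<longrightarrow> x \<in> cball a r \<longrightarrow>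
           (LINT s:cball a r|lborel. f s) < (f x + e) * (2 * r)"
proof -
  define S where "S = (\<lambda>p q R. {x \<in> ball 0 R. f x < p \<and>
    (\<forall>d>0. \<exists>a r. 0 < r \<and> r < d \<and> x \<in> cball a r \<and>
       ennreal (q * (2 * r)) \<le> emeasure (density lborel (\<lambda>s. ennreal (f s))) (cball a r))})"
  have S: "AE x in lborel. x \<notin> S p q R" if "0 \<le> p" "p < q" for p q R
  proof -
    have "negligible (S p q R)"
      unfolding S_def using that f by (intro negligible_upper_mean_gap) auto
    then have "AE x in lebesgue. x \<notin> S p q R"
      by (intro AE_not_in) (simp add: negligible_iff_null_sets)
    then show ?thesis by (simp add: AE_completion_iff)
  qed
  have "AE x in lborel. \<forall>p\<in>\<rat>. \<forall>q\<in>\<rat>. \<forall>R::nat. 0 \<le> p \<longrightarrow> p < q \<longrightarrow> x \<notin> S p q (real R)"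
    using S by (simp add: AE_ball_countable countable_rat AE_all_countable)
  then show ?thesis
  proof (eventually_elim, intro allI impI)
    fix x e :: real assume x: "\<forall>p\<in>\<rat>. \<forall>q\<in>\<rat>. \<forall>R::nat. 0 \<le> p \<longrightarrow> p < q \<longrightarrow> x \<notin> S p q (real R)" and e: "0 < e"
    obtain p where p: "p \<in> \<rat>" "f x < p" "p < f x + e"
      using Rats_dense_in_real[of "f x" "f x + e"] e by auto
    obtain q where q: "q \<in> \<rat>" "p < q" "q < f x + e"
      using Rats_dense_in_real[of p "f x + e"] p by auto
    obtain R :: nat where R: "\<bar>x\<bar> < real R" using reals_Archimedean2 by blast
    have p0: "0 \<le> p" using p(2) f(1)[of x] by simp
    have "x \<notin> S p q (real R)" using x p q p0 by blast
    then obtain d where d: "d > 0" and dd: "\<And>a r. 0 < r \<Longrightarrow> r < d \<Longrightarrow> x \<in> cball a r \<Longrightarrow>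
       emeasure (density lborel (\<lambda>s. ennreal (f s))) (cball a r) < ennreal (q * (2 * r))"
      using R p(2) unfolding S_def by (auto simp: not_le dest!: not_le_imp_less) (metis linorder_not_less)
    show "\<exists>d>0. \<forall>a r. 0 < r \<longrightarrow> r < d \<longrightarrow> x \<in> cball a r \<longrightarrow>
           (LINT s:cball a r|lborel. f s) < (f x + e) * (2 * r)"
    proof (intro exI[of _ d] conjI allI impI d)
      fix a r :: real assume r: "0 < r" "r < d" "x \<in> cball a r"
      have "emeasure (density lborel (\<lambda>s. ennreal (f s))) (cball a r)
          = (\<integral>\<^sup>+s. ennreal (indicator (cball a r) s *\<^sub>R f s) \<partial>lborel)"
        by (subst emeasure_density) (auto intro!: nn_integral_cong simp: indicator_def)
      also have "\<dots> = ennreal (LINT s:cball a r|lborel. f s)"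
        unfolding set_lebesgue_integral_def
        using set_integrable_bounded_cball[OF assms(1) f] f
        by (intro nn_integral_eq_integral) (auto simp: set_integrable_def)
      finally have "ennreal (LINT s:cball a r|lborel. f s) < ennreal (q * (2 * r))"
        using dd[OF r] by simp
      then have "(LINT s:cball a r|lborel. f s) < q * (2 * r)"
        by (rule ennreal_less_iff[THEN iffD1, rotated])
           (auto simp: set_lebesgue_integral_def f indicator_def intro!: integral_nonneg_AE)
      also have "\<dots> \<le> (f x + e) * (2 * r)" using q r by (intro mult_right_mono) auto
      finally show "(LINT s:cball a r|lborel. f s) < (f x + e) * (2 * r)" .
    qed
  qed
qed

text \<open>The bounds 0 \<le> f \<le> 1 make the upper estimate applicable to f and to 1 - f, and
  the second is a lower estimate for the means of f. The difference quotient at t is the mean over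
  the interval between x and t, a ball with x on its boundary.\<close>

theorem AE_has_real_derivative_set_integral_atMost:
  fixes f :: "real \<Rightarrow> real"
  assumes int: "integrable lborel f" and f: "\<And>x. 0 \<le> f x" "\<And>x. f x \<le> 1"
  shows "AE x in lborel. ((\<lambda>t. LINT s:{..t}|lborel. f s) has_real_derivative f x) (at x)"
proof -
  have m[measurable]: "f \<in> borel_measurable borel"
    using borel_measurable_integrable[OF int] by simp
  have m1: "(\<lambda>x. 1 - f x) \<in> borel_measurable borel" by measurable
  have si: "set_integrable lborel A f" if "A \<in> sets borel" for A
    unfolding set_integrable_def using int that by (intro integrable_mult_indicator) auto
  define \<Phi> where "\<Phi> = (\<lambda>t. LINT s:{..t}|lborel. f s)"
  have diff: "\<Phi> v - \<Phi> u = (LINT s:cball ((u + v) / 2) ((v - u) / 2)|lborel. f s)" if "u < v" for u v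
  proof -
    have "\<Phi> v = (LINT s:{..u} \<union> {u<..v}|lborel. f s)"
      using that unfolding \<Phi>_def by (simp add: ivl_disj_un)
    also have "\<dots> = \<Phi> u + (LINT s:{u<..v}|lborel. f s)"
      unfolding \<Phi>_def by (intro set_integral_Un) (auto intro: si)
    also have "(LINT s:{u<..v}|lborel. f s) = (LINT s:{u..v}|lborel. f s)"
      unfolding set_lebesgue_integral_def
      by (intro integral_cong_AE)
         (use AE_lborel_singleton[of u] in \<open>auto simp: indicator_def elim!: eventually_mono\<close>)
    also have "{u..v} = cball ((u + v) / 2) ((v - u) / 2)"
      by (simp add: cball_eq_atLeastAtMost field_simps)
    finally show ?thesis by simp
  qed
  have one: "(LINT s:cball a r|lborel. 1 - f s) = 2 * r - (LINT s:cball a r|lborel. f s)" if "0 < r" for a r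
  proof -
    have "(LINT s:cball a r|lborel. 1 - f s) = (LINT s:cball a r|lborel. 1) - (LINT s:cball a r|lborel. f s)"
      using set_integrable_bounded_cball[of "\<lambda>_. 1"] by (intro set_integral_diff) (auto intro: si)
    also have "(LINT s:cball a r|lborel. 1) = 2 * r"
      using that by (simp add: set_lebesgue_integral_def cball_eq_atLeastAtMost)
    finally show ?thesis .
  qed
  have "AE x in lborel. (\<forall>e>0. \<exists>d>0. \<forall>a r. 0 < r \<longrightarrow> r < d \<longrightarrow> x \<in> cball a r \<longrightarrow>
           (LINT s:cball a r|lborel. f s) < (f x + e) * (2 * r)) \<and>
       (\<forall>e>0. \<exists>d>0. \<forall>a r. 0 < r \<longrightarrow> r < d \<longrightarrow> x \<in> cball a r \<longrightarrow>
           (LINT s:cball a r|lborel. 1 - f s) < (1 - f x + e) * (2 * r))"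
    using AE_upper_mean_le[OF m f] AE_upper_mean_le[OF m1] f by (simp add: AE_conj_iff)
  then show ?thesis
  proof eventually_elim
    case (elim x)
    have "((\<lambda>t. (\<Phi> t - \<Phi> x) / (t - x)) \<longlongrightarrow> f x) (at x)"
    proof (rule tendstoI)
      fix e :: real assume e: "e > 0"
      obtain d1 where d1: "d1 > 0" "\<And>a r. 0 < r \<Longrightarrow> r < d1 \<Longrightarrow> x \<in> cball a r \<Longrightarrow>
           (LINT s:cball a r|lborel. f s) < (f x + e) * (2 * r)" using elim e by blast
      obtain d2 where d2: "d2 > 0" "\<And>a r. 0 < r \<Longrightarrow> r < d2 \<Longrightarrow> x \<in> cball a r \<Longrightarrow>
           (LINT s:cball a r|lborel. 1 - f s) < (1 - f x + e) * (2 * r)" using elim e by blast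
      have "dist ((\<Phi> t - \<Phi> x) / (t - x)) (f x) < e" if t: "t \<noteq> x" "dist t x < min d1 d2" for t
      proof -
        define u v where "u = min t x" and "v = max t x"
        have uv: "u < v" using t by (auto simp: u_def v_def)
        let ?a = "(u + v) / 2" and ?r = "(v - u) / 2"
        have r: "0 < ?r" "?r < d1" "?r < d2" and x: "x \<in> cball ?a ?r"
        proof -
          have "\<bar>t - x\<bar> = v - u" by (simp add: u_def v_def)
          then show "0 < ?r" "?r < d1" "?r < d2" using t uv by (auto simp: dist_real_def)
          have "u \<le> x" "x \<le> v" by (auto simp: u_def v_def)
          then show "x \<in> cball ?a ?r" by (simp add: cball_eq_atLeastAtMost field_simps)
        qed
        have q: "(\<Phi> t - \<Phi> x) / (t - x) = (\<Phi> v - \<Phi> u) / (v - u)"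
        proof (cases "t < x")
          case True
          then have "u = t" "v = x" by (auto simp: u_def v_def)
          then show ?thesis by (metis minus_diff_eq minus_divide_divide)
        qed (simp add: u_def v_def)
        have 1: "\<Phi> v - \<Phi> u < (f x + e) * (v - u)"
          using d1(2)[OF r(1,2) x] diff[OF uv] by (simp add: algebra_simps)
        have "2 * ?r - (\<Phi> v - \<Phi> u) < (1 - f x + e) * (2 * ?r)"
          using d2(2)[OF r(1,3) x] unfolding one[OF r(1)] diff[OF uv] .
        moreover have "2 * ?r = v - u" by simp
        ultimately have "(v - u) - (\<Phi> v - \<Phi> u) < (1 - f x + e) * (v - u)" by metis
        then have 2: "(f x - e) * (v - u) < \<Phi> v - \<Phi> u" by (simp add: algebra_simps)
        show ?thesis unfolding q dist_real_def abs_less_iff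
          using 1 2 uv by (simp add: field_simps)
      qed
      then show "\<forall>\<^sub>F t in at x. dist ((\<Phi> t - \<Phi> x) / (t - x)) (f x) < e"
        unfolding eventually_at using d1(1) d2(1) by (intro exI[of _ "min d1 d2"]) auto
    qed
    then show ?case unfolding has_field_derivative_iff \<Phi>_def .
  qed
qed


section \<open>Quantile and probability integral transforms\<close>

lemma prob_space_unif01: "prob_space unif01"
  by (rule prob_space_uniform_measure) auto

lemma unif01_eq_density: "unif01 = density lborel (indicator {0..1})"
  unfolding uniform_measure_def by (simp add: divide_ennreal_def)

lemma nn_integral_unif01:
  assumes [measurable]: "h \<in> borel_measurable borel"
  shows "(\<integral>\<^sup>+x. h x \<partial>unif01) = (\<integral>\<^sup>+x. indicator {0..1} x * h x \<partial>lborel)"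
  unfolding unif01_eq_density by (subst nn_integral_density) auto

lemma AE_unif01_Ioo: "AE x in unif01. 0 < x \<and> x < 1"
proof -
  have "AE x in lborel. 0 < (indicator {0..1::real} x :: ennreal) \<longrightarrow> 0 < x \<and> x < 1"
    using AE_lborel_singleton[of "0::real"] AE_lborel_singleton[of "1::real"]
    by eventually_elim (auto simp: indicator_def)
  then show ?thesis
    unfolding unif01_eq_density by (subst AE_density) auto
qed

lemma (in real_distribution) cdf_distribution_M: "cdf_distribution M"
  ..

text \<open>Monotone on the open unit interval; for p \<le> 0 the value is \<open>Inf UNIV\<close>
  and for p > 1 it is \<open>Inf {}\<close>, both constant. The junk pieces have to be covered
  because \<open>unif01\<close> carries the Borel sets of the whole line.\<close>

lemma (in real_distribution) borel_measurable_quantile_cdf [measurable]: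
  "quantile (cdf M) \<in> borel_measurable borel"
proof (rule borel_measurable_piecewise_mono[of "{{..0}, {0<..<1}, {1}, {1<..}}"])
  interpret cdf_distribution M by (rule cdf_distribution_M)
  have "{x. p \<le> cdf M x} = UNIV" if "p \<le> 0" for p
    using that cdf_nonneg order_trans by auto
  then have 1: "mono_on {..0} (quantile (cdf M))"
    by (auto simp: mono_on_def quantile_def)
  have "{x. p \<le> cdf M x} = {}" if "1 < p" for p
    using that cdf_bounded_prob by (auto simp: not_le intro: le_less_trans)
  then have 2: "mono_on {1<..} (quantile (cdf M))"
    by (auto simp: mono_on_def quantile_def)
  have 3: "mono_on {0<..<1} (quantile (cdf M))"
    using mono_I unfolding quantile_def .
  show "mono_on c (quantile (cdf M))" if "c \<in> {{..0}, {0<..<1}, {1}, {1<..}}" for c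
    using that 1 2 3 by (auto simp: mono_on_def)
  show "\<Union>{{..0}, {0<..<1}, {1::real}, {1<..}} = UNIV"
    by auto
qed auto

text \<open>\<open>distr_I_eq_M\<close> is this fact on the open unit interval; what remains is that
  the two endpoints are Lebesgue-null.\<close>

lemma (in real_distribution) distr_unif01_quantile:
  "distr unif01 borel (quantile (cdf M)) = M"
proof -
  interpret cdf_distribution M by (rule cdf_distribution_M)
  have "distr unif01 borel (quantile (cdf M)) = distr (restrict_space lborel {0<..<1::real}) borel (quantile (cdf M))"
  proof (rule measure_eqI)
    fix A assume "A \<in> sets (distr unif01 borel (quantile (cdf M)))"
    then have A[measurable]: "A \<in> sets borel" by simp
    have m: "quantile (cdf M) \<in> measurable (restrict_space lborel {0<..<1::real}) borel"
      by (intro measurable_restrict_space1) simp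
    have "emeasure (distr unif01 borel (quantile (cdf M))) A = (\<integral>\<^sup>+x. indicator A (quantile (cdf M) x) \<partial>unif01)"
      by (subst nn_integral_indicator[symmetric], simp, subst nn_integral_distr) auto
    also have "\<dots> = (\<integral>\<^sup>+x. indicator A (quantile (cdf M) x) * indicator {0<..<1} x \<partial>lborel)"
    proof (subst nn_integral_unif01)
      have "AE x in lborel. indicator {0..1} x * indicator A (quantile (cdf M) x)
        = (indicator A (quantile (cdf M) x) * indicator {0<..<1} x :: ennreal)"
        using AE_lborel_singleton[of "0::real"] AE_lborel_singleton[of "1::real"]
        by eventually_elim (auto simp: indicator_def)
      then show "(\<integral>\<^sup>+x. indicator {0..1} x * indicator A (quantile (cdf M) x) \<partial>lborel)
        = (\<integral>\<^sup>+x. indicator A (quantile (cdf M) x) * indicator {0<..<1} x \<partial>lborel)"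
        by (rule nn_integral_cong_AE)
    qed simp
    also have "\<dots> = (\<integral>\<^sup>+x. indicator A (quantile (cdf M) x) \<partial>restrict_space lborel {0<..<1})"
      by (subst nn_integral_restrict_space) auto
    also have "\<dots> = emeasure (distr (restrict_space lborel {0<..<1::real}) borel (quantile (cdf M))) A"
      by (subst nn_integral_indicator[symmetric], simp, subst nn_integral_distr) (auto simp: m)
    finally show "emeasure (distr unif01 borel (quantile (cdf M))) A
       = emeasure (distr (restrict_space lborel {0<..<1::real}) borel (quantile (cdf M))) A" .
  qed simp
  also have "\<dots> = M" using distr_I_eq_M unfolding quantile_def .
  finally show ?thesis .
qed

text \<open>Continuity of the cdf makes \<open>quantile\<close> a right inverse everywhere on the
  open unit interval. As a left inverse it works only almost everywhere, since the cdf may have flat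
  stretches.\<close>

locale atomless_real_distribution = real_distribution +
  assumes no_atoms: "\<And>x. measure M {x} = 0"
begin

text \<open>Write H for the cdf and q for the quantile. The Galois connection gives p \<le> H(q) and
  H(x) < p for x < q; since H does not jump at q, the limit from the left gives H(q) \<le>
  p.\<close>

lemma cdf_quantile:
  assumes p: "0 < p" "p < 1"
  shows "cdf M (quantile (cdf M) p) = p"
proof -
  interpret cdf_distribution M by (rule cdf_distribution_M)
  let ?q = "quantile (cdf M) p"
  have gal: "p \<le> cdf M x \<longleftrightarrow> ?q \<le> x" for x
    unfolding quantile_def by (rule pseudoinverse[OF p])
  have "((cdf M) \<longlongrightarrow> cdf M ?q) (at_left ?q)"
  proof (rule tendsto_within_subset[OF _ subset_UNIV])
    show "(cdf M \<longlongrightarrow> cdf M ?q) (at ?q)"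
      using isCont_cdf[of ?q] no_atoms[of ?q] unfolding isCont_def by simp
  qed
  moreover have "\<forall>\<^sub>F x in at_left ?q. cdf M x \<le> p"
    unfolding eventually_at_filter
  proof (intro always_eventually allI impI)
    fix x assume "x \<in> {..<?q}"
    then show "cdf M x \<le> p" using gal[of x] by simp
  qed
  ultimately have "cdf M ?q \<le> p"
    by (intro tendsto_upperbound) auto
  with gal[of ?q] show ?thesis by simp
qed

lemma distr_cdf: "distr M borel (cdf M) = unif01"
proof -
  have [measurable]: "cdf M \<in> borel_measurable borel"
    by (intro borel_measurable_mono monoI cdf_nondecreasing)
  have "distr M borel (cdf M) = distr (distr unif01 borel (quantile (cdf M))) borel (cdf M)"
    by (simp add: distr_unif01_quantile)
  also have "\<dots> = distr unif01 borel (cdf M \<circ> quantile (cdf M))"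
    by (subst distr_distr) auto
  also have "\<dots> = distr unif01 unif01 (\<lambda>x. x)"
  proof (intro distr_cong_AE)
    show "AE x in unif01. (cdf M \<circ> quantile (cdf M)) x = x"
      using AE_unif01_Ioo by eventually_elim (simp add: cdf_quantile)
  qed auto
  also have "\<dots> = unif01" by (rule distr_id)
  finally show ?thesis .
qed

text \<open>The equation holds at every point \<open>quantile (cdf M) p\<close> with 0 < p < 1 by
  \<open>cdf_quantile\<close>. As M is the image of \<open>unif01\<close> under the quantile
  function, these points carry the full mass.\<close>

lemma AE_quantile_cdf: "AE x in M. quantile (cdf M) (cdf M x) = x"
proof -
  have [measurable]: "cdf M \<in> borel_measurable borel"
    by (intro borel_measurable_mono monoI cdf_nondecreasing)
  have "AE x in distr unif01 borel (quantile (cdf M)). quantile (cdf M) (cdf M x) = x"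
  proof (subst AE_distr_iff)
    show "AE x in unif01. quantile (cdf M) (cdf M (quantile (cdf M) x)) = quantile (cdf M) x"
      using AE_unif01_Ioo by eventually_elim (simp add: cdf_quantile)
  qed auto
  then show ?thesis unfolding distr_unif01_quantile .
qed

end


section \<open>The conditional law of a bivariate copula\<close>

text \<open>The conditional law of the second coordinate given that the first equals u. At
  exceptional u its total mass may differ from 1.\<close>

definition cond_law :: "(real \<Rightarrow> real \<Rightarrow> real) \<Rightarrow> real \<Rightarrow> real measure" where
  "cond_law c u = density unif01 (\<lambda>s. ennreal (c u s))"

text \<open>The good points u: here the \<open>deriv\<close> inside \<open>copula2_cond_cdf\<close>
  may be replaced by a genuine continuous cdf, for all v at once.\<close>

definition cond_law_regular :: "(real \<Rightarrow> real \<Rightarrow> real) \<Rightarrow> real \<Rightarrow> bool" where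
  "cond_law_regular c u \<longleftrightarrow> atomless_real_distribution (cond_law c u) \<and>
     (\<forall>v. copula2_cond_cdf c v u = cdf (cond_law c u) v)"

lemma sets_cond_law [measurable_cong, simp]: "sets (cond_law c u) = sets borel"
  by (simp add: cond_law_def)

lemma space_cond_law: "space (cond_law c u) = UNIV"
  by (simp add: cond_law_def)

context
  fixes c :: "real \<Rightarrow> real \<Rightarrow> real"
  assumes c2: "copula2_density c"
begin

lemma copula2_density_measurable [measurable]:
  "case_prod c \<in> borel_measurable (borel \<Otimes>\<^sub>M borel)"
  using c2 by (simp add: copula2_density_def)

lemma copula2_density_measurable1 [measurable]: "c u \<in> borel_measurable borel"
proof -
  have "(\<lambda>v. case_prod c (u, v)) \<in> borel_measurable borel" by measurable
  then show ?thesis by simp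
qed

lemma copula2_density_nonneg: "0 \<le> c u v"
  using c2 by (simp add: copula2_density_def)

lemma emeasure_copula2_law_Times:
  assumes [measurable]: "A \<in> sets borel" "B \<in> sets borel"
  shows "emeasure (copula2_law c) (A \<times> B) =
    (\<integral>\<^sup>+u. indicator A u * emeasure (cond_law c u) B \<partial>unif01)"
proof -
  interpret prob_space unif01 by (rule prob_space_unif01)
  have "emeasure (copula2_law c) (A \<times> B) =
      (\<integral>\<^sup>+z. (case z of (u, v) \<Rightarrow> ennreal (c u v)) * indicator (A \<times> B) z \<partial>(unif01 \<Otimes>\<^sub>M unif01))"
    unfolding copula2_law_def by (subst emeasure_density) auto
  also have "\<dots> = (\<integral>\<^sup>+u. \<integral>\<^sup>+v. ennreal (c u v) * indicator (A \<times> B) (u, v) \<partial>unif01 \<partial>unif01)"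
    by (subst nn_integral_fst[symmetric]) auto
  also have "\<dots> = (\<integral>\<^sup>+u. indicator A u * (\<integral>\<^sup>+v. ennreal (c u v) * indicator B v \<partial>unif01) \<partial>unif01)"
    by (intro nn_integral_cong, subst nn_integral_cmult[symmetric])
       (auto simp: indicator_def intro!: nn_integral_cong)
  also have "\<dots> = (\<integral>\<^sup>+u. indicator A u * emeasure (cond_law c u) B \<partial>unif01)"
    unfolding cond_law_def by (intro nn_integral_cong, subst emeasure_density) auto
  finally show ?thesis .
qed

lemma borel_measurable_emeasure_cond_law [measurable]:
  "B \<in> sets borel \<Longrightarrow> (\<lambda>u. emeasure (cond_law c u) B) \<in> borel_measurable borel"
proof -
  assume [measurable]: "B \<in> sets borel"
  interpret prob_space unif01 by (rule prob_space_unif01)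
  have "(\<lambda>u. emeasure (cond_law c u) B) = (\<lambda>u. \<integral>\<^sup>+v. ennreal (c u v) * indicator B v \<partial>unif01)"
    unfolding cond_law_def by (intro ext, subst emeasure_density) auto
  also have "\<dots> \<in> borel_measurable borel" by measurable
  finally show ?thesis .
qed

text \<open>This joint measurability is the reason why \<open>cdf (cond_law c u) v\<close>, and not
  \<open>copula2_cond_cdf\<close>, appears under all integrals below.\<close>

lemma borel_measurable_cdf_cond_law [measurable]:
  "(\<lambda>(u, v). cdf (cond_law c u) v) \<in> borel_measurable (borel \<Otimes>\<^sub>M borel)"
proof -
  interpret prob_space unif01 by (rule prob_space_unif01)
  have "(\<lambda>(u, v). cdf (cond_law c u) v)
      = (\<lambda>(u, v). enn2real (\<integral>\<^sup>+s. ennreal (c u s) * indicator {x. x \<le> v} s \<partial>unif01))"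
    unfolding cond_law_def cdf_def measure_def by (intro ext, clarsimp, subst emeasure_density) (auto simp: atMost_def)
  also have "\<dots> \<in> borel_measurable (borel \<Otimes>\<^sub>M borel)"
    unfolding indicator_def by measurable
  finally show ?thesis .
qed

text \<open>As a function of u, the total mass of \<open>cond_law c u\<close> is the density of the
  first margin with respect to \<open>unif01\<close>. That margin is uniform, so uniqueness of
  densities makes the mass 1.\<close>

lemma AE_prob_space_cond_law: "AE u in unif01. prob_space (cond_law c u)"
proof -
  interpret prob_space unif01 by (rule prob_space_unif01)
  have "density unif01 (\<lambda>u. emeasure (cond_law c u) UNIV) = density unif01 (\<lambda>_. 1)"
  proof (rule measure_eqI)
    fix A :: "real set" assume "A \<in> sets (density unif01 (\<lambda>u. emeasure (cond_law c u) UNIV))"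
    then have A[measurable]: "A \<in> sets borel" by simp
    have fst[measurable]: "fst \<in> measurable (copula2_law c) borel"
      unfolding copula2_law_def by (subst measurable_cong_sets[OF sets_density refl]) measurable
    have "emeasure (density unif01 (\<lambda>u. emeasure (cond_law c u) UNIV)) A
        = (\<integral>\<^sup>+u. indicator A u * emeasure (cond_law c u) UNIV \<partial>unif01)"
      by (subst emeasure_density) (auto simp: mult.commute)
    also have "\<dots> = emeasure (copula2_law c) (A \<times> UNIV)"
      by (subst emeasure_copula2_law_Times) auto
    also have "A \<times> UNIV = fst -` A \<inter> space (copula2_law c)"
      by (auto simp: copula2_law_def space_pair_measure)
    also have "emeasure (copula2_law c) \<dots> = emeasure (distr (copula2_law c) borel fst) A"
      by (subst emeasure_distr) auto
    also have "distr (copula2_law c) borel fst = unif01"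
      using c2 by (simp add: copula2_density_def)
    finally show "emeasure (density unif01 (\<lambda>u. emeasure (cond_law c u) UNIV)) A = emeasure (density unif01 (\<lambda>_. 1)) A"
      by (simp add: density_1)
  qed simp
  then have "AE u in unif01. emeasure (cond_law c u) UNIV = 1"
    by (intro density_unique) auto
  then show ?thesis
    by eventually_elim (auto intro!: prob_spaceI simp: cond_law_def)
qed

lemma atomless_cond_law:
  assumes "prob_space (cond_law c u)"
  shows "atomless_real_distribution (cond_law c u)"
proof -
  interpret prob_space "cond_law c u" by fact
  have "emeasure (cond_law c u) {x} = 0" for x
  proof -
    have "AE s in lborel. s \<noteq> x" by (rule AE_lborel_singleton)
    then have "AE s in unif01. s \<noteq> x"
      unfolding unif01_eq_density by (subst AE_density) auto
    then have "AE s in cond_law c u. s \<noteq> x"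
      unfolding cond_law_def by (subst AE_density) auto
    then show ?thesis by (subst (asm) AE_iff_measurable[OF _ refl]) (auto simp: space_cond_law)
  qed
  then show ?thesis
    by unfold_locales (auto simp: measure_def)
qed

lemma AE_copula2_cdf_has_derivative:
  "AE u in unif01. ((\<lambda>t. copula2_cdf c t v) has_real_derivative cdf (cond_law c u) v) (at u)"
proof -
  interpret prob_space unif01 by (rule prob_space_unif01)
  \<comment> \<open>The density of t |-> C(t, v). The cap at 1 takes effect only at exceptional u
    and supplies the bound at every point that the differentiation theorem demands.\<close>
  define f where "f = (\<lambda>u. indicator {0..1} u * min 1 (cdf (cond_law c u) v))"
  have cm[measurable]: "(\<lambda>u. cdf (cond_law c u) v) \<in> borel_measurable borel"
  proof -
    have "(\<lambda>u. case_prod (\<lambda>u v. cdf (cond_law c u) v) (u, v)) \<in> borel_measurable borel" by measurable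
    then show ?thesis by simp
  qed
  have [measurable]: "f \<in> borel_measurable borel" unfolding f_def by measurable
  have f01: "0 \<le> f u" "f u \<le> 1" for u by (auto simp: f_def cdf_def indicator_def)
  have fint: "integrable lborel f"
  proof (rule integrableI_bounded_set[where A="{0..1}" and B=1])
    show "AE u in lborel. u \<in> {0..1} \<longrightarrow> norm (f u) \<le> 1" using f01 by simp
  qed (auto simp: f_def)
  have cdf_eq: "copula2_cdf c t v = (LINT s:{..t}|lborel. f s)" for t
  proof -
    have "emeasure (copula2_law c) ({..t} \<times> {..v}) = (\<integral>\<^sup>+u. indicator {..t} u * emeasure (cond_law c u) {..v} \<partial>unif01)"
      by (rule emeasure_copula2_law_Times) auto
    also have "\<dots> = (\<integral>\<^sup>+u. indicator {..t} u * ennreal (min 1 (cdf (cond_law c u) v)) \<partial>unif01)"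
    proof (rule nn_integral_cong_AE)
      show "AE u in unif01. indicator {..t} u * emeasure (cond_law c u) {..v}
          = indicator {..t} u * ennreal (min 1 (cdf (cond_law c u) v))"
        using AE_prob_space_cond_law
      proof eventually_elim
        case (elim u)
        interpret u: prob_space "cond_law c u" by fact
        show ?case by (simp add: u.emeasure_eq_measure cdf_def min_absorb2)
      qed
    qed
    also have "\<dots> = (\<integral>\<^sup>+u. ennreal (indicator {..t} u *\<^sub>R f u) \<partial>lborel)"
      by (subst nn_integral_unif01) (auto intro!: nn_integral_cong simp: f_def indicator_def)
    also have "\<dots> = ennreal (LINT s:{..t}|lborel. f s)"
      unfolding set_lebesgue_integral_def
      by (intro nn_integral_eq_integral integrable_mult_indicator fint) (auto simp: f01)
    finally show ?thesis
      unfolding copula2_cdf_def measure_def set_lebesgue_integral_def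
      by (simp add: integral_nonneg_AE f01)
  qed
  have "AE u in lborel. ((\<lambda>t. copula2_cdf c t v) has_real_derivative f u) (at u)"
    unfolding cdf_eq by (rule AE_has_real_derivative_set_integral_atMost[OF fint f01])
  then have "AE u in unif01. u \<in> {0..1} \<and> ((\<lambda>t. copula2_cdf c t v) has_real_derivative f u) (at u)"
    unfolding unif01_eq_density by (subst AE_density) (auto elim!: eventually_mono simp: indicator_def split: if_splits)
  then show ?thesis using AE_prob_space_cond_law
  proof eventually_elim
    case (elim u)
    interpret u: prob_space "cond_law c u" using elim by simp
    have "f u = cdf (cond_law c u) v" using elim by (simp add: f_def cdf_def min_absorb2)
    then show ?case using elim by simp
  qed
qed

section \<open>Differentiability of the copula at all v simultaneously\<close>

lemma prob_space_copula2_law: "prob_space (copula2_law c)"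
proof -
  have fst[measurable]: "fst \<in> measurable (copula2_law c) borel"
    unfolding copula2_law_def by (subst measurable_cong_sets[OF sets_density refl]) measurable
  have "prob_space (distr (copula2_law c) borel fst)"
    using c2 prob_space_unif01 by (simp add: copula2_density_def)
  then show ?thesis by (rule prob_space_distrD[OF fst])
qed

lemma copula2_cdf_increment:
  assumes "u \<le> t"
  shows "copula2_cdf c t v - copula2_cdf c u v = measure (copula2_law c) ({u<..t} \<times> {..v})"
proof -
  interpret prob_space "copula2_law c" by (rule prob_space_copula2_law)
  have s: "sets (copula2_law c) = sets (borel \<Otimes>\<^sub>M borel)"
    unfolding copula2_law_def by (simp cong: sets_pair_measure_cong)
  have "{..t} \<times> {..v} = {..u} \<times> {..v} \<union> {u<..t} \<times> {..v}" using assms by auto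
  then have "copula2_cdf c t v = measure (copula2_law c) ({..u} \<times> {..v} \<union> {u<..t} \<times> {..v})"
    by (simp add: copula2_cdf_def)
  also have "\<dots> = copula2_cdf c u v + measure (copula2_law c) ({u<..t} \<times> {..v})"
    unfolding copula2_cdf_def by (intro finite_measure_Union) (auto simp: s)
  finally show ?thesis by simp
qed

text \<open>Up to sign the numerator is the mass of the strip between u and t below height v, which
  grows with v; dividing by t - u removes the sign.\<close>

lemma copula2_cdf_quotient_mono:
  assumes "v \<le> v'" "t \<noteq> u"
  shows "(copula2_cdf c t v - copula2_cdf c u v) / (t - u) \<le> (copula2_cdf c t v' - copula2_cdf c u v') / (t - u)"
proof -
  interpret prob_space "copula2_law c" by (rule prob_space_copula2_law)
  have s: "sets (copula2_law c) = sets (borel \<Otimes>\<^sub>M borel)"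
    unfolding copula2_law_def by (simp cong: sets_pair_measure_cong)
  have *: "copula2_cdf c b v - copula2_cdf c a v \<le> copula2_cdf c b v' - copula2_cdf c a v'" if "a \<le> b" for a b
    unfolding copula2_cdf_increment[OF that]
    using assms(1) by (intro finite_measure_mono) (auto simp: s)
  show ?thesis
  proof (cases "u < t")
    case True
    then show ?thesis using *[of u t] by (intro divide_right_mono) auto
  next
    case False
    then have "t < u" using assms by simp
    then show ?thesis using *[of t u] by (intro divide_right_mono_neg) auto
  qed
qed

text \<open>The difference quotients are monotone in \<open>v\<close> and the limit is continuous in \<open>v\<close>, so convergence
  at all rational \<open>v\<close> forces convergence at all \<open>v\<close>.\<close>

lemma AE_cond_law_regular: "AE u in unif01. cond_law_regular c u"
proof -
  have "AE u in unif01. \<forall>v\<in>\<rat>. ((\<lambda>t. copula2_cdf c t v) has_real_derivative cdf (cond_law c u) v) (at u)"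
    using AE_copula2_cdf_has_derivative by (simp add: AE_ball_countable countable_rat)
  then show ?thesis using AE_prob_space_cond_law
  proof eventually_elim
    case (elim u)
    interpret u: atomless_real_distribution "cond_law c u"
      using elim by (intro atomless_cond_law)
    let ?H = "cdf (cond_law c u)"
    let ?q = "\<lambda>v t. (copula2_cdf c t v - copula2_cdf c u v) / (t - u)"
    have rat: "(?q v \<longlongrightarrow> ?H v) (at u)" if "v \<in> \<rat>" for v
      using elim that by (simp add: has_field_derivative_iff)
    have "copula2_cond_cdf c v u = ?H v" for v
    proof -
      have "(?q v \<longlongrightarrow> ?H v) (at u)"
      proof (rule order_tendstoI)
        have cont: "isCont ?H v" using u.isCont_cdf u.no_atoms by simp
        fix a assume "a < ?H v"
        then have "\<forall>\<^sub>F x in at_left v. a < ?H x"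
          using cont by (auto simp: isCont_def intro: order_tendstoD(1) filterlim_at_split[THEN iffD1, THEN conjunct1])
        then obtain b where b: "b < v" "\<And>y. b < y \<Longrightarrow> y < v \<Longrightarrow> a < ?H y"
          unfolding eventually_at_left_field by blast
        \<comment> \<open>At a rational r just below v the limit still exceeds a, so the quotients
          at r eventually do, and those at v dominate them.\<close>
        obtain r where r: "r \<in> \<rat>" "b < r" "r < v" using Rats_dense_in_real[OF b(1)] by blast
        have "\<forall>\<^sub>F t in at u. a < ?q r t"
          using b(2)[OF r(2,3)] rat[OF r(1)] by (rule order_tendstoD(1)[rotated])
        then show "\<forall>\<^sub>F t in at u. a < ?q v t"
          using eventually_neq_at_within[of u] 
        proof eventually_elim
          case (elim t)
          then show ?case using copula2_cdf_quotient_mono[of r v t u] r(3) by simp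
        qed
      next
        have cont: "isCont ?H v" using u.isCont_cdf u.no_atoms by simp
        fix a assume "?H v < a"
        then have "\<forall>\<^sub>F x in at_right v. ?H x < a"
          using cont by (auto simp: isCont_def intro: order_tendstoD(2) filterlim_at_split[THEN iffD1, THEN conjunct2])
        then obtain b where b: "v < b" "\<And>y. v < y \<Longrightarrow> y < b \<Longrightarrow> ?H y < a"
          unfolding eventually_at_right_field by blast
        obtain r where r: "r \<in> \<rat>" "v < r" "r < b" using Rats_dense_in_real[OF b(1)] by blast
        have "\<forall>\<^sub>F t in at u. ?q r t < a"
          using b(2)[OF r(2,3)] rat[OF r(1)] by (rule order_tendstoD(2)[rotated])
        then show "\<forall>\<^sub>F t in at u. ?q v t < a"
          using eventually_neq_at_within[of u] 
        proof eventually_elim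
          case (elim t)
          then show ?case using copula2_cdf_quotient_mono[of v r t u] r(2) by simp
        qed
      qed
      then have "((\<lambda>t. copula2_cdf c t v) has_real_derivative ?H v) (at u)"
        by (simp add: has_field_derivative_iff)
      then show ?thesis unfolding copula2_cond_cdf_def by (rule DERIV_imp_deriv)
    qed
    then show ?case
      unfolding cond_law_regular_def using u.atomless_real_distribution_axioms by blast
  qed
qed

end


section \<open>Substitution and conditional expectation\<close>

text \<open>Almost everywhere y equals \<open>quantile (cdf M) (cdf M y)\<close>, so the integrand
  is a function of \<open>cdf M y\<close>, whose law is \<open>unif01\<close>. Integrability is
  stated as an equivalence so that the substitution can be used before anything is known about
  moments.\<close>

lemma (in atomless_real_distribution) integrable_cdf_iff:
  fixes a \<kappa> :: "real \<Rightarrow> real"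
  assumes [measurable]: "a \<in> borel_measurable borel" "\<kappa> \<in> borel_measurable borel"
  shows "integrable M (\<lambda>y. a y * \<kappa> (cdf M y)) \<longleftrightarrow> integrable unif01 (\<lambda>t. a (quantile (cdf M) t) * \<kappa> t)"
    and "(LINT y|M. a y * \<kappa> (cdf M y)) = (LINT t|unif01. a (quantile (cdf M) t) * \<kappa> t)"
proof -
  have [measurable]: "cdf M \<in> borel_measurable borel"
    by (intro borel_measurable_mono monoI cdf_nondecreasing)
  have eq: "AE y in M. a y * \<kappa> (cdf M y) = a (quantile (cdf M) (cdf M y)) * \<kappa> (cdf M y)"
    using AE_quantile_cdf by eventually_elim simp
  have "integrable M (\<lambda>y. a y * \<kappa> (cdf M y)) \<longleftrightarrow> integrable M (\<lambda>y. a (quantile (cdf M) (cdf M y)) * \<kappa> (cdf M y))"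
    using eq by (intro integrable_cong_AE) auto
  also have "\<dots> \<longleftrightarrow> integrable (distr M borel (cdf M)) (\<lambda>t. a (quantile (cdf M) t) * \<kappa> t)"
    by (subst integrable_distr_eq) auto
  finally show "integrable M (\<lambda>y. a y * \<kappa> (cdf M y)) \<longleftrightarrow> integrable unif01 (\<lambda>t. a (quantile (cdf M) t) * \<kappa> t)"
    unfolding distr_cdf .
  have "(LINT y|M. a y * \<kappa> (cdf M y)) = (LINT y|M. a (quantile (cdf M) (cdf M y)) * \<kappa> (cdf M y))"
    using eq by (intro integral_cong_AE) auto
  also have "\<dots> = (LINT t|distr M borel (cdf M). a (quantile (cdf M) t) * \<kappa> t)"
    by (subst integral_distr) auto
  finally show "(LINT y|M. a y * \<kappa> (cdf M y)) = (LINT t|unif01. a (quantile (cdf M) t) * \<kappa> t)"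
    unfolding distr_cdf .
qed

lemma unif01_integral_eq:
  fixes h :: "real \<Rightarrow> real"
  assumes [measurable]: "h \<in> borel_measurable borel"
  shows "integrable unif01 h \<longleftrightarrow> set_integrable lborel {0..1} h"
    and "(LINT t|unif01. h t) = (LINT t:{0..1}|lborel. h t)"
proof -
  have eq: "unif01 = density lborel (\<lambda>x. ennreal (indicator {0..1} x))"
    unfolding unif01_eq_density by (intro density_cong) (auto simp: indicator_def)
  show "integrable unif01 h \<longleftrightarrow> set_integrable lborel {0..1} h"
    unfolding eq set_integrable_def by (subst integrable_density) auto
  show "(LINT t|unif01. h t) = (LINT t:{0..1}|lborel. h t)"
    unfolding eq set_lebesgue_integral_def by (subst integral_density) auto
qed

text \<open>Two applications of \<open>integrable_cdf_iff\<close>: v = G(y) turns g(y) dy into dv,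
  and t = C_{2|1}(v|u) turns c(u, v) dv into dt. The function \<kappa> will be the quotient of the
  c3 densities with w held fixed.\<close>

lemma integrable_copula_substitution:
  fixes g \<kappa> :: "real \<Rightarrow> real"
  assumes c: "copula2_density c" and u: "cond_law_regular c u"
    and g[measurable]: "g \<in> borel_measurable borel" and g0: "\<And>y. 0 \<le> g y"
    and L: "atomless_real_distribution (density lborel (\<lambda>y. ennreal (g y)))"
    and G: "G = cdf (density lborel (\<lambda>y. ennreal (g y)))"
    and \<kappa>[measurable]: "\<kappa> \<in> borel_measurable borel"
  shows "integrable lborel (\<lambda>y. y * (g y * c u (G y) * \<kappa> (cdf (cond_law c u) (G y)))) \<longleftrightarrow>
      set_integrable lborel {0..1} (\<lambda>t. quantile G (quantile (cdf (cond_law c u)) t) * \<kappa> t)"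
    and "(LINT y|lborel. y * (g y * c u (G y) * \<kappa> (cdf (cond_law c u) (G y)))) =
      (LINT t:{0..1}|lborel. quantile G (quantile (cdf (cond_law c u)) t) * \<kappa> t)"
proof -
  interpret L: atomless_real_distribution "density lborel (\<lambda>y. ennreal (g y))" by (rule L)
  interpret u: atomless_real_distribution "cond_law c u" using u by (simp add: cond_law_regular_def)
  note [measurable] = copula2_density_measurable1[OF c]
  have [measurable]: "G \<in> borel_measurable borel"
    unfolding G by (intro borel_measurable_mono monoI L.cdf_nondecreasing)
  have H[measurable]: "cdf (cond_law c u) \<in> borel_measurable borel"
    by (intro borel_measurable_mono monoI u.cdf_nondecreasing)
  have [measurable]: "quantile G \<in> borel_measurable borel"
    unfolding G by (rule L.borel_measurable_quantile_cdf)
  have 1: "integrable lborel (\<lambda>y. y * (g y * c u (G y) * \<kappa> (cdf (cond_law c u) (G y))))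
     \<longleftrightarrow> integrable (density lborel (\<lambda>y. ennreal (g y))) (\<lambda>y. y * (c u (G y) * \<kappa> (cdf (cond_law c u) (G y))))"
    by (subst integrable_density) (auto simp: g0 ac_simps)
  have i1: "(LINT y|lborel. y * (g y * c u (G y) * \<kappa> (cdf (cond_law c u) (G y))))
     = (LINT y|density lborel (\<lambda>y. ennreal (g y)). y * (c u (G y) * \<kappa> (cdf (cond_law c u) (G y))))"
    by (subst integral_density) (auto simp: g0 ac_simps)
  have m: "(\<lambda>v. quantile G v * \<kappa> (cdf (cond_law c u) v)) \<in> borel_measurable unif01"
    "c u \<in> borel_measurable unif01"
    by (simp_all add: measurable_cong_sets[of unif01 borel borel borel])
  have 3: "integrable unif01 (\<lambda>v. quantile G v * (c u v * \<kappa> (cdf (cond_law c u) v)))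
      \<longleftrightarrow> integrable (cond_law c u) (\<lambda>v. quantile G v * \<kappa> (cdf (cond_law c u) v))"
    by (subst (2) cond_law_def, subst integrable_density[OF m])
       (auto simp: copula2_density_nonneg[OF c] ac_simps)
  have i3: "(LINT v|unif01. quantile G v * (c u v * \<kappa> (cdf (cond_law c u) v)))
      = (LINT v|cond_law c u. quantile G v * \<kappa> (cdf (cond_law c u) v))"
    by (subst (2) cond_law_def, subst integral_density[OF m])
       (auto simp: copula2_density_nonneg[OF c] ac_simps)
  note 2 = L.integrable_cdf_iff[of "\<lambda>y. y" "\<lambda>v. c u v * \<kappa> (cdf (cond_law c u) v)", folded G]
  note 4 = u.integrable_cdf_iff[of "quantile G" \<kappa>]
  note 5 = unif01_integral_eq[of "\<lambda>t. quantile G (quantile (cdf (cond_law c u)) t) * \<kappa> t"]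
  show "integrable lborel (\<lambda>y. y * (g y * c u (G y) * \<kappa> (cdf (cond_law c u) (G y)))) \<longleftrightarrow>
      set_integrable lborel {0..1} (\<lambda>t. quantile G (quantile (cdf (cond_law c u)) t) * \<kappa> t)"
    unfolding 1 by (subst 2(1)) (auto simp: 3 4(1) 5(1))
  show "(LINT y|lborel. y * (g y * c u (G y) * \<kappa> (cdf (cond_law c u) (G y)))) =
      (LINT t:{0..1}|lborel. quantile G (quantile (cdf (cond_law c u)) t) * \<kappa> t)"
    unfolding i1 by (subst 2(2)) (auto simp: i3 4(2) 5(2))
qed

section \<open>From a disintegration to conditional expectations\<close>

text \<open>\<open>joint\<close> expresses that the law of (Z, T) is the law of Z followed by the
  kernel k. Its right-hand side integrates over M instead of the law of Z, so Fubini is applied on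
  the product of M with \<open>lborel\<close>. Normalisation of k comes out of the result with
  \<phi> = 1.\<close>

lemma (in prob_space) real_cond_exp_conditional_density:
  fixes k :: "'z \<Rightarrow> real \<Rightarrow> real" and \<phi> :: "real \<Rightarrow> real"
  assumes Z[measurable]: "Z \<in> measurable M N" and T[measurable]: "T \<in> borel_measurable M"
    and k[measurable]: "case_prod k \<in> borel_measurable (N \<Otimes>\<^sub>M borel)" and k0: "\<And>z y. 0 \<le> k z y"
    and joint: "\<And>\<Theta>. \<Theta> \<in> borel_measurable (N \<Otimes>\<^sub>M borel) \<Longrightarrow>
       (\<integral>\<^sup>+\<omega>. \<Theta> (Z \<omega>, T \<omega>) \<partial>M) = (\<integral>\<^sup>+\<omega>. \<integral>\<^sup>+y. \<Theta> (Z \<omega>, y) * ennreal (k (Z \<omega>) y) \<partial>lborel \<partial>M)"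
    and \<phi>[measurable]: "\<phi> \<in> borel_measurable borel" and int: "integrable M (\<lambda>\<omega>. \<phi> (T \<omega>))"
  shows "AE \<omega> in M. integrable lborel (\<lambda>y. \<phi> y * k (Z \<omega>) y) \<and>
    real_cond_exp M (vimage_algebra (space M) Z N) (\<lambda>\<omega>. \<phi> (T \<omega>)) \<omega> = (LINT y|lborel. \<phi> y * k (Z \<omega>) y)"
proof -
  interpret P: pair_sigma_finite M lborel ..
  let ?F = "vimage_algebra (space M) Z N"
  have ZF: "Z \<in> measurable ?F N"
    using measurable_space[OF Z] by (intro measurable_vimage_algebra1) auto
  have sub: "subalgebra M ?F"
    unfolding subalgebra_def using measurable_space[OF Z] by (auto simp: sets_vimage_algebra2)
  interpret finite_measure_subalgebra M ?F
    by unfold_locales (rule sub)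
  have k'[measurable]: "(\<lambda>p. k (Z (fst p)) (snd p)) \<in> borel_measurable (M \<Otimes>\<^sub>M lborel)"
  proof -
    have "(\<lambda>p. case_prod k (Z (fst p), snd p)) \<in> borel_measurable (M \<Otimes>\<^sub>M lborel)" by measurable
    then show ?thesis by simp
  qed
  have pair: "(\<integral>\<^sup>+\<omega>. \<Theta> (Z \<omega>, T \<omega>) \<partial>M) = (\<integral>\<^sup>+p. \<Theta> (Z (fst p), snd p) * ennreal (k (Z (fst p)) (snd p)) \<partial>(M \<Otimes>\<^sub>M lborel))"
    if [measurable]: "\<Theta> \<in> borel_measurable (N \<Otimes>\<^sub>M borel)" for \<Theta>
    unfolding joint[OF that] by (subst lborel.nn_integral_fst[symmetric]) auto
  have sec: "(\<lambda>p. \<phi> (snd p) * k (Z (fst p)) (snd p)) \<in> borel_measurable (M \<Otimes>\<^sub>M lborel)"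
    by measurable
  \<comment> \<open>For the test function |\<phi>| the joint law identifies the product integral
    with the finite expectation of |\<phi>(T)|.\<close>
  have intP: "integrable (M \<Otimes>\<^sub>M lborel) (\<lambda>p. \<phi> (snd p) * k (Z (fst p)) (snd p))"
  proof (rule integrableI_bounded[OF sec])
    have "(\<integral>\<^sup>+p. ennreal (norm (\<phi> (snd p) * k (Z (fst p)) (snd p))) \<partial>(M \<Otimes>\<^sub>M lborel))
        = (\<integral>\<^sup>+\<omega>. ennreal \<bar>\<phi> (T \<omega>)\<bar> \<partial>M)"
      by (subst pair[of "\<lambda>p. ennreal \<bar>\<phi> (snd p)\<bar>", simplified])
         (auto simp: abs_mult k0 ennreal_mult intro!: nn_integral_cong)
    also have "\<dots> < \<infinity>" using int by (simp add: integrable_iff_bounded)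
    finally show "(\<integral>\<^sup>+p. ennreal (norm (\<phi> (snd p) * k (Z (fst p)) (snd p))) \<partial>(M \<Otimes>\<^sub>M lborel)) < \<infinity>" .
  qed
  have "AE \<omega> in M. integrable lborel (\<lambda>y. \<phi> y * k (Z \<omega>) y)"
    using P.AE_integrable_fst'[OF intP] by simp
  moreover have "AE \<omega> in M. real_cond_exp M ?F (\<lambda>\<omega>. \<phi> (T \<omega>)) \<omega> = (LINT y|lborel. \<phi> y * k (Z \<omega>) y)"
  proof (rule real_cond_exp_charact[OF _ int])
    show "integrable M (\<lambda>\<omega>. LINT y|lborel. \<phi> y * k (Z \<omega>) y)"
      using P.integrable_fst'[OF intP] by simp
    have "(\<lambda>z. LINT y|lborel. \<phi> y * k z y) \<in> borel_measurable N"
      by (rule lborel.borel_measurable_lebesgue_integral) measurable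
    from measurable_compose[OF ZF this]
    show "(\<lambda>\<omega>. LINT y|lborel. \<phi> y * k (Z \<omega>) y) \<in> borel_measurable ?F" .
    fix A assume "A \<in> sets ?F"
    then obtain B where B[measurable]: "B \<in> sets N" and A: "A = Z -` B \<inter> space M"
      using measurable_space[OF Z] by (auto simp: sets_vimage_algebra2)
    have indA: "indicator A \<omega> = indicator B (Z \<omega>)" if "\<omega> \<in> space M" for \<omega>
      using that by (simp add: A indicator_def)
    let ?f = "\<lambda>\<omega>. indicator B (Z \<omega>) * \<phi> (T \<omega>)"
    let ?h = "\<lambda>p. indicator B (Z (fst p)) * (\<phi> (snd p) * k (Z (fst p)) (snd p))"
    have "integrable M (\<lambda>\<omega>. indicator (Z -` B \<inter> space M) \<omega> *\<^sub>R \<phi> (T \<omega>))"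
      by (intro integrable_mult_indicator int) auto
    also have "?this \<longleftrightarrow> integrable M ?f"
      by (intro Bochner_Integration.integrable_cong) (auto simp: indicator_def)
    finally have fi: "integrable M ?f" .
    have "integrable (M \<Otimes>\<^sub>M lborel) (\<lambda>p. indicator ((\<lambda>p. Z (fst p)) -` B \<inter> space (M \<Otimes>\<^sub>M lborel)) p *\<^sub>R (\<phi> (snd p) * k (Z (fst p)) (snd p)))"
      by (intro integrable_mult_indicator intP measurable_sets[of _ _ N]) auto
    also have "?this \<longleftrightarrow> integrable (M \<Otimes>\<^sub>M lborel) ?h"
      by (intro Bochner_Integration.integrable_cong) (auto simp: indicator_def)
    finally have hi: "integrable (M \<Otimes>\<^sub>M lborel) ?h" .
    have "(LINT \<omega>:A|M. \<phi> (T \<omega>)) = (LINT \<omega>|M. ?f \<omega>)"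
      unfolding set_lebesgue_integral_def by (intro Bochner_Integration.integral_cong) (auto simp: indA)
    also have "\<dots> = (LINT p|(M \<Otimes>\<^sub>M lborel). ?h p)"
    \<comment> \<open>\<open>joint\<close> speaks of nonnegative test functions, so positive and
      negative parts are treated apart; k \<ge> 0 allows it to be pulled out of
      \<open>ennreal\<close> in both.\<close>
    proof -
      have "(\<integral>\<^sup>+\<omega>. ennreal (?f \<omega>) \<partial>M) = (\<integral>\<^sup>+p. ennreal (?h p) \<partial>(M \<Otimes>\<^sub>M lborel))"
        by (subst pair[of "\<lambda>p. ennreal (indicator B (fst p) * \<phi> (snd p))", simplified])
           (simp_all add: ennreal_mult''[OF k0, symmetric] mult.assoc)
      moreover have "(\<integral>\<^sup>+\<omega>. ennreal (- ?f \<omega>) \<partial>M) = (\<integral>\<^sup>+p. ennreal (- ?h p) \<partial>(M \<Otimes>\<^sub>M lborel))"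
        by (subst pair[of "\<lambda>p. ennreal (- (indicator B (fst p) * \<phi> (snd p)))", simplified])
           (simp_all add: ennreal_mult''[OF k0, symmetric] mult.assoc)
      ultimately show ?thesis
        by (simp add: real_lebesgue_integral_def[OF fi] real_lebesgue_integral_def[OF hi])
    qed
    also have "\<dots> = (LINT \<omega>|M. LINT y|lborel. indicator B (Z \<omega>) * (\<phi> y * k (Z \<omega>) y))"
      using P.integral_fst'[OF hi] by simp
    also have "\<dots> = (LINT \<omega>:A|M. LINT y|lborel. \<phi> y * k (Z \<omega>) y)"
      unfolding set_lebesgue_integral_def by (intro Bochner_Integration.integral_cong) (auto simp: indA)
    finally show "(LINT \<omega>:A|M. \<phi> (T \<omega>)) = (LINT \<omega>:A|M. LINT y|lborel. \<phi> y * k (Z \<omega>) y)" .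
  qed
  ultimately show ?thesis by eventually_elim simp
qed


section \<open>Products and margins\<close>

lemma density_PiM_const:
  fixes f :: "'b \<Rightarrow> ennreal"
  assumes I: "finite I" and M: "sigma_finite_measure M" and D: "sigma_finite_measure (density M f)"
    and f[measurable]: "f \<in> borel_measurable M"
  shows "density (\<Pi>\<^sub>M i\<in>I. M) (\<lambda>x. \<Prod>i\<in>I. f (x i)) = (\<Pi>\<^sub>M i\<in>I. density M f)"
proof -
  interpret M: product_sigma_finite "\<lambda>_. M" by (simp add: product_sigma_finite_def M)
  interpret D: product_sigma_finite "\<lambda>_. density M f" by (simp add: product_sigma_finite_def D)
  note [simp] = I
  show ?thesis
  proof (rule D.PiM_eqI[OF I])
    show "sets (density (\<Pi>\<^sub>M i\<in>I. M) (\<lambda>x. \<Prod>i\<in>I. f (x i))) = sets (\<Pi>\<^sub>M i\<in>I. density M f)"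
      by (simp cong: sets_PiM_cong)
    fix A assume "\<And>i. i \<in> I \<Longrightarrow> A i \<in> sets (density M f)"
    then have A[measurable]: "\<And>i. i \<in> I \<Longrightarrow> A i \<in> sets M" by simp
    have "emeasure (density (\<Pi>\<^sub>M i\<in>I. M) (\<lambda>x. \<Prod>i\<in>I. f (x i))) (Pi\<^sub>E I A) =
       (\<integral>\<^sup>+x. (\<Prod>i\<in>I. f (x i)) * indicator (Pi\<^sub>E I A) x \<partial>(\<Pi>\<^sub>M i\<in>I. M))"
      by (subst emeasure_density) (auto intro!: sets_PiM_I_finite A)
    also have "\<dots> = (\<integral>\<^sup>+x. (\<Prod>i\<in>I. f (x i) * indicator (A i) (x i)) \<partial>(\<Pi>\<^sub>M i\<in>I. M))"
    proof (rule nn_integral_cong)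
      fix x assume "x \<in> space (\<Pi>\<^sub>M i\<in>I. M)"
      then have "x \<in> Pi\<^sub>E I A \<longleftrightarrow> (\<forall>i\<in>I. x i \<in> A i)"
        by (auto simp: space_PiM PiE_def)
      then have "indicator (Pi\<^sub>E I A) x = (\<Prod>i\<in>I. indicator (A i) (x i) :: ennreal)"
        by (cases "\<forall>i\<in>I. x i \<in> A i") (auto simp: indicator_def)
      then show "(\<Prod>i\<in>I. f (x i)) * indicator (Pi\<^sub>E I A) x = (\<Prod>i\<in>I. f (x i) * indicator (A i) (x i))"
        by (simp add: prod.distrib)
    qed
    also have "\<dots> = (\<Prod>i\<in>I. emeasure (density M f) (A i))"
      by (subst M.product_nn_integral_prod) (auto simp: emeasure_density intro!: prod.cong)
    finally show "emeasure (density (\<Pi>\<^sub>M i\<in>I. M) (\<lambda>x. \<Prod>i\<in>I. f (x i))) (Pi\<^sub>E I A) =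
      (\<Prod>i\<in>I. emeasure (density M f) (A i))" .
  qed
qed

lemma measurable_cond_cdf_copula2_law:
  assumes c: "copula2_density c"
  shows "(\<lambda>z. cdf (cond_law c (fst z)) (snd z)) \<in> borel_measurable (copula2_law c)"
proof -
  note [measurable] = borel_measurable_cdf_cond_law[OF c]
  have "(\<lambda>z. case_prod (\<lambda>u v. cdf (cond_law c u) v) z) \<in> borel_measurable (unif01 \<Otimes>\<^sub>M unif01)"
    by measurable
  then show ?thesis
    unfolding copula2_law_def by (simp add: case_prod_beta')
qed

text \<open>The Rosenblatt transform: for regular u the cdf of \<open>cond_law c u\<close> carries
  this law to \<open>unif01\<close>, whatever u is, so averaging over u changes nothing.\<close>

lemma distr_copula2_law_cond_cdf:
  assumes c: "copula2_density c"
  shows "distr (copula2_law c) unif01 (\<lambda>z. cdf (cond_law c (fst z)) (snd z)) = unif01"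
proof (rule measure_eqI)
  interpret U: prob_space unif01 by (rule prob_space_unif01)
  note m[measurable] = measurable_cond_cdf_copula2_law[OF c] copula2_density_measurable[OF c]
  note cc[measurable] = borel_measurable_cdf_cond_law[OF c]
  have mm[measurable]: "(\<lambda>z. cdf (cond_law c (fst z)) (snd z)) \<in> borel_measurable (unif01 \<Otimes>\<^sub>M unif01)"
    using m(1) unfolding copula2_law_def by simp
  fix A assume "A \<in> sets (distr (copula2_law c) unif01 (\<lambda>z. cdf (cond_law c (fst z)) (snd z)))"
  then have A[measurable]: "A \<in> sets borel" by simp
  have "emeasure (distr (copula2_law c) unif01 (\<lambda>z. cdf (cond_law c (fst z)) (snd z))) A
      = (\<integral>\<^sup>+x. indicator A x \<partial>distr (copula2_law c) unif01 (\<lambda>z. cdf (cond_law c (fst z)) (snd z)))"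
    by (simp add: nn_integral_indicator)
  also have "\<dots> = (\<integral>\<^sup>+z. indicator A (cdf (cond_law c (fst z)) (snd z)) \<partial>copula2_law c)"
    by (subst nn_integral_distr) (auto simp: m(1) intro!: borel_measurable_indicator)
  also have "\<dots> = (\<integral>\<^sup>+z. (case z of (u, v) \<Rightarrow> ennreal (c u v)) * indicator A (cdf (cond_law c (fst z)) (snd z)) \<partial>(unif01 \<Otimes>\<^sub>M unif01))"
    unfolding copula2_law_def by (subst nn_integral_density) auto
  also have "\<dots> = (\<integral>\<^sup>+u. \<integral>\<^sup>+v. ennreal (c u v) * indicator A (cdf (cond_law c u) v) \<partial>unif01 \<partial>unif01)"
    by (subst U.nn_integral_fst[symmetric]) auto
  also have "\<dots> = (\<integral>\<^sup>+u. emeasure unif01 A \<partial>unif01)"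
  proof (rule nn_integral_cong_AE)
    show "AE u in unif01. (\<integral>\<^sup>+v. ennreal (c u v) * indicator A (cdf (cond_law c u) v) \<partial>unif01) = emeasure unif01 A"
      using AE_cond_law_regular[OF c]
    proof eventually_elim
      case (elim u)
      interpret u: atomless_real_distribution "cond_law c u" using elim by (simp add: cond_law_regular_def)
      have H: "cdf (cond_law c u) \<in> borel_measurable borel"
        by (intro borel_measurable_mono monoI u.cdf_nondecreasing)
      have cu: "c u \<in> borel_measurable borel" by (rule copula2_density_measurable1[OF c])
      have "(\<integral>\<^sup>+v. ennreal (c u v) * indicator A (cdf (cond_law c u) v) \<partial>unif01)
          = (\<integral>\<^sup>+v. indicator A (cdf (cond_law c u) v) \<partial>cond_law c u)"
      proof (subst (2) cond_law_def, subst nn_integral_density)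
        show "(\<lambda>s. ennreal (c u s)) \<in> borel_measurable unif01"
          using cu by (simp add: measurable_cong_sets[of unif01 borel borel borel])
        show "(\<lambda>v. indicator A (cdf (cond_law c u) v)) \<in> borel_measurable unif01"
          using measurable_compose[OF H borel_measurable_indicator[OF A]]
          by (simp add: measurable_cong_sets[of unif01 borel borel borel])
      qed (rule refl)
      also have "\<dots> = (\<integral>\<^sup>+t. indicator A t \<partial>distr (cond_law c u) borel (cdf (cond_law c u)))"
        using H by (subst nn_integral_distr) auto
      also have "\<dots> = emeasure unif01 A" unfolding u.distr_cdf by simp
      finally show ?case .
    qed
  qed
  also have "\<dots> = emeasure unif01 A" by (simp add: U.emeasure_space_1[simplified])
  finally show "emeasure (distr (copula2_law c) unif01 (\<lambda>z. cdf (cond_law c (fst z)) (snd z))) A = emeasure unif01 A" .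
qed simp

text \<open>Under the product of the copula laws the scores are independent uniforms, so null sets
  of w pull back to null sets of that product. Its density is the product of the c factors, whence
  the restriction to points where this is nonzero: elsewhere a set of positive Lebesgue measure may
  collapse to a single score vector.\<close>

lemma AE_PiM_cond_cdf:
  assumes c: "copula2_density c" and I: "finite I" and P: "AE w in (\<Pi>\<^sub>M j\<in>I. unif01). P w"
  shows "AE r in (\<Pi>\<^sub>M j\<in>I. unif01 \<Otimes>\<^sub>M unif01). (\<Prod>j\<in>I. c (fst (r j)) (snd (r j))) \<noteq> 0 \<longrightarrow>
      P (\<lambda>j\<in>I. cdf (cond_law c (fst (r j))) (snd (r j)))"
proof -
  let ?\<mu> = "unif01 \<Otimes>\<^sub>M unif01" and ?K = "copula2_law c"
  let ?T = "\<lambda>z. cdf (cond_law c (fst z)) (snd z)"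
  interpret U: prob_space unif01 by (rule prob_space_unif01)
  interpret UU: pair_prob_space unif01 unif01 ..
  interpret K: prob_space ?K by (rule prob_space_copula2_law[OF c])
  note m[measurable] = copula2_density_measurable[OF c] measurable_cond_cdf_copula2_law[OF c]
  have fm[measurable]: "(\<lambda>(u, v). ennreal (c u v)) \<in> borel_measurable ?\<mu>" by measurable
  have "distr (\<Pi>\<^sub>M j\<in>I. ?K) (\<Pi>\<^sub>M j\<in>I. unif01) (compose I ?T) = (\<Pi>\<^sub>M j\<in>I. distr ?K unif01 ?T)"
    by (intro distr_PiM_finite_prob_space' I K.prob_space_axioms U.prob_space_axioms)
       (simp add: measurable_cong_sets[of ?K ?K unif01 borel] m(2))
  also have "\<dots> = (\<Pi>\<^sub>M j\<in>I. unif01)" unfolding distr_copula2_law_cond_cdf[OF c] ..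
  finally have "AE w in distr (\<Pi>\<^sub>M j\<in>I. ?K) (\<Pi>\<^sub>M j\<in>I. unif01) (compose I ?T). P w"
    using P by (rule ssubst)
  moreover have "compose I ?T \<in> measurable (\<Pi>\<^sub>M j\<in>I. ?K) (\<Pi>\<^sub>M j\<in>I. unif01)"
    unfolding compose_def
    by (intro measurable_restrict) (auto intro: measurable_compose[OF measurable_component_singleton] simp: measurable_cong_sets[of ?K ?K unif01 borel] m(2))
  ultimately have P: "AE r in (\<Pi>\<^sub>M j\<in>I. ?K). P (compose I ?T r)"
    by (rule AE_distrD[rotated])
  have eq: "(\<Pi>\<^sub>M j\<in>I. ?K) = density (\<Pi>\<^sub>M j\<in>I. ?\<mu>) (\<lambda>x. \<Prod>j\<in>I. (\<lambda>(u, v). ennreal (c u v)) (x j))"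
    unfolding copula2_law_def
    by (intro density_PiM_const[symmetric] I UU.sigma_finite_measure_axioms fm)
       (use K.sigma_finite_measure_axioms in \<open>simp add: copula2_law_def\<close>)
  have "AE r in density (\<Pi>\<^sub>M j\<in>I. ?\<mu>) (\<lambda>x. \<Prod>j\<in>I. (\<lambda>(u, v). ennreal (c u v)) (x j)). P (compose I ?T r)"
    using P unfolding eq .
  then have "AE r in (\<Pi>\<^sub>M j\<in>I. ?\<mu>). 0 < (\<Prod>j\<in>I. (\<lambda>(u, v). ennreal (c u v)) (r j)) \<longrightarrow> P (compose I ?T r)"
    by (subst (asm) AE_density) auto
  then show ?thesis
  proof eventually_elim
    case (elim r)
    have "(\<Prod>j\<in>I. (\<lambda>(u, v). ennreal (c u v)) (r j)) = ennreal (\<Prod>j\<in>I. c (fst (r j)) (snd (r j)))"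
      by (simp add: case_prod_beta' prod_ennreal copula2_density_nonneg[OF c])
    moreover have "0 \<le> (\<Prod>j\<in>I. c (fst (r j)) (snd (r j)))"
      by (intro prod_nonneg) (auto simp: copula2_density_nonneg[OF c])
    ultimately show ?case using elim by (auto simp: compose_def less_le)
  qed
qed

lemma sets_PiM_unif01 [simp]: "sets (\<Pi>\<^sub>M j\<in>I. unif01) = sets (\<Pi>\<^sub>M j\<in>I. borel)"
  by (intro sets_PiM_cong) auto

text \<open>Consistency of the family is given for laws. Integrating out the last coordinate shows
  that both sides are densities of the same m-variate law, and uniqueness of densities yields the
  identity up to a null set of w.\<close>

lemma AE_exchangeable_margin:
  assumes c: "exchangeable_copula_family c" and m: "1 \<le> m"
  shows "AE w in (\<Pi>\<^sub>M j\<in>{1..m}. unif01). (\<integral>\<^sup>+t. ennreal (c (Suc m) (w(Suc m := t))) \<partial>unif01) = ennreal (c m w)"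
proof -
  interpret U: prob_space unif01 by (rule prob_space_unif01)
  interpret P: product_prob_space "\<lambda>_. unif01" by unfold_locales
  interpret Pm: prob_space "\<Pi>\<^sub>M j\<in>{1..m}. unif01" by (intro prob_space_PiM prob_space_unif01)
  have ins: "{1..Suc m} = insert (Suc m) {1..m}" using m by auto
  have cm: "c k \<in> borel_measurable (\<Pi>\<^sub>M j\<in>{1..k}. unif01)" if "1 \<le> k" for k
    using c that by (simp add: exchangeable_copula_family_def copula_density_def measurable_cong_sets[OF sets_PiM_unif01 refl])
  have cS[measurable]: "c (Suc m) \<in> borel_measurable (\<Pi>\<^sub>M j\<in>insert (Suc m) {1..m}. unif01)"
    using cm[of "Suc m"] unfolding ins by simp
  have cm'[measurable]: "c m \<in> borel_measurable (\<Pi>\<^sub>M j\<in>{1..m}. unif01)" using cm m by simp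
  have upd[measurable]: "(\<lambda>p. (fst p)(Suc m := snd p)) \<in> measurable ((\<Pi>\<^sub>M j\<in>{1..m}. unif01) \<Otimes>\<^sub>M unif01) (\<Pi>\<^sub>M j\<in>insert (Suc m) {1..m}. unif01)"
    by (intro measurable_fun_upd[where J="{1..m}"]) auto
  have J[measurable]: "(\<lambda>w. \<integral>\<^sup>+t. ennreal (c (Suc m) (w(Suc m := t))) \<partial>unif01) \<in> borel_measurable (\<Pi>\<^sub>M j\<in>{1..m}. unif01)"
  proof -
    have "(\<lambda>p. ennreal (c (Suc m) ((fst p)(Suc m := snd p)))) \<in> borel_measurable ((\<Pi>\<^sub>M j\<in>{1..m}. unif01) \<Otimes>\<^sub>M unif01)"
      by measurable
    from U.borel_measurable_nn_integral_fst[OF this] show ?thesis by simp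
  qed
  have "density (\<Pi>\<^sub>M j\<in>{1..m}. unif01) (\<lambda>w. \<integral>\<^sup>+t. ennreal (c (Suc m) (w(Suc m := t))) \<partial>unif01) =
    density (\<Pi>\<^sub>M j\<in>{1..m}. unif01) (\<lambda>w. ennreal (c m w))"
  proof (rule measure_eqI)
    fix A assume "A \<in> sets (density (\<Pi>\<^sub>M j\<in>{1..m}. unif01) (\<lambda>w. \<integral>\<^sup>+t. ennreal (c (Suc m) (w(Suc m := t))) \<partial>unif01))"
    then have A[measurable]: "A \<in> sets (\<Pi>\<^sub>M j\<in>{1..m}. unif01)" and A': "A \<in> sets (\<Pi>\<^sub>M j\<in>{1..m}. borel)" by simp_all
    have r[measurable]: "(\<lambda>x. restrict x {1..m}) \<in> measurable (\<Pi>\<^sub>M j\<in>insert (Suc m) {1..m}. unif01) (\<Pi>\<^sub>M j\<in>{1..m}. unif01)"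
      by (intro measurable_restrict_subset) auto
    let ?L = "copula_law (Suc m) (c (Suc m))"
    have cE: "(\<lambda>x. ennreal (c (Suc m) x)) \<in> borel_measurable (\<Pi>\<^sub>M j\<in>insert (Suc m) {1..m}. unif01)" by measurable
    have iA: "(\<lambda>x. indicator A (restrict x {1..m}) :: ennreal) \<in> borel_measurable (\<Pi>\<^sub>M j\<in>insert (Suc m) {1..m}. unif01)"
      by (rule measurable_compose[OF r borel_measurable_indicator[OF A]])
    have rL: "(\<lambda>x. restrict x {1..m}) \<in> measurable ?L (\<Pi>\<^sub>M j\<in>{1..m}. borel)"
      using r unfolding copula_law_def ins by (simp add: measurable_cong_sets[OF refl sets_PiM_unif01])
    have "emeasure (density (\<Pi>\<^sub>M j\<in>{1..m}. unif01) (\<lambda>w. ennreal (c m w))) A = emeasure (copula_law m (c m)) A"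
      by (simp add: copula_law_def)
    also have "copula_law m (c m) = distr ?L (\<Pi>\<^sub>M j\<in>{1..m}. borel) (\<lambda>x. restrict x {1..m})"
    proof -
      have "1 \<le> Suc m" "m \<in> {1..Suc m}" using m by auto
      then show ?thesis using c unfolding exchangeable_copula_family_def by metis
    qed
    also have "emeasure \<dots> A = (\<integral>\<^sup>+x. indicator A x \<partial>distr ?L (\<Pi>\<^sub>M j\<in>{1..m}. borel) (\<lambda>x. restrict x {1..m}))"
      using A' by simp
    also have "\<dots> = (\<integral>\<^sup>+x. indicator A (restrict x {1..m}) \<partial>?L)"
      using A' by (subst nn_integral_distr[OF rL]) auto
    also have "\<dots> = (\<integral>\<^sup>+x. ennreal (c (Suc m) x) * indicator A (restrict x {1..m}) \<partial>(\<Pi>\<^sub>M j\<in>insert (Suc m) {1..m}. unif01))"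
      unfolding copula_law_def ins
      by (subst nn_integral_density[OF cE iA]) (rule refl)
    also have "\<dots> = (\<integral>\<^sup>+w. \<integral>\<^sup>+t. ennreal (c (Suc m) (w(Suc m := t))) * indicator A (restrict (w(Suc m := t)) {1..m}) \<partial>unif01 \<partial>(\<Pi>\<^sub>M j\<in>{1..m}. unif01))"
      by (rule P.product_nn_integral_insert) (auto intro!: borel_measurable_times_ennreal cE iA simp del: One_nat_def)
    also have "\<dots> = (\<integral>\<^sup>+w. (\<integral>\<^sup>+t. ennreal (c (Suc m) (w(Suc m := t))) \<partial>unif01) * indicator A w \<partial>(\<Pi>\<^sub>M j\<in>{1..m}. unif01))"
    proof (rule nn_integral_cong)
      fix w assume w: "w \<in> space (\<Pi>\<^sub>M j\<in>{1..m}. unif01)"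
      then have "restrict (w(Suc m := t)) {1..m} = w" for t
        by (auto simp: space_PiM PiE_def extensional_def restrict_def fun_eq_iff)
      moreover have "(\<lambda>t. c (Suc m) (w(Suc m := t))) \<in> borel_measurable unif01"
        using measurable_compose[OF measurable_component_update[OF w] cS] by simp
      ultimately show "(\<integral>\<^sup>+t. ennreal (c (Suc m) (w(Suc m := t))) * indicator A (restrict (w(Suc m := t)) {1..m}) \<partial>unif01)
        = (\<integral>\<^sup>+t. ennreal (c (Suc m) (w(Suc m := t))) \<partial>unif01) * indicator A w"
        by (simp add: nn_integral_multc)
    qed
    also have "\<dots> = emeasure (density (\<Pi>\<^sub>M j\<in>{1..m}. unif01) (\<lambda>w. \<integral>\<^sup>+t. ennreal (c (Suc m) (w(Suc m := t))) \<partial>unif01)) A"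
      by (subst emeasure_density[OF J A]) (rule refl)
    finally show "emeasure (density (\<Pi>\<^sub>M j\<in>{1..m}. unif01) (\<lambda>w. \<integral>\<^sup>+t. ennreal (c (Suc m) (w(Suc m := t))) \<partial>unif01)) A
       = emeasure (density (\<Pi>\<^sub>M j\<in>{1..m}. unif01) (\<lambda>w. ennreal (c m w))) A" by simp
  qed simp
  then show ?thesis by (intro Pm.density_unique J) measurable
qed


section \<open>The conditional density on the unit cube\<close>

text \<open>The w_j of the theorem on the copula scale, in the form that is measurable at all
  points, including irregular ones.\<close>

definition copula_scores :: "(real \<Rightarrow> real \<Rightarrow> real) \<Rightarrow> nat \<Rightarrow> (nat \<Rightarrow> real \<times> real) \<Rightarrow> nat \<Rightarrow> real" where
  "copula_scores c m r = (\<lambda>j\<in>{1..m}. cdf (cond_law c (fst (r j))) (snd (r j)))"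

text \<open>The candidate for the conditional density of V_n, n = m + 1, where x pairs u_n with the
  m earlier pairs. Division by zero makes it 0 where \<open>c3 m\<close> vanishes.\<close>

definition copula_cond_density ::
  "(real \<Rightarrow> real \<Rightarrow> real) \<Rightarrow> (nat \<Rightarrow> (nat \<Rightarrow> real) \<Rightarrow> real) \<Rightarrow> nat \<Rightarrow> real \<times> (nat \<Rightarrow> real \<times> real) \<Rightarrow> real \<Rightarrow> real" where
  "copula_cond_density c2 c3 m x v = c2 (fst x) v *
     (c3 (Suc m) ((copula_scores c2 m (snd x))(Suc m := cdf (cond_law c2 (fst x)) v)) / c3 m (copula_scores c2 m (snd x)))"

lemma exchangeable_copula_family_measurable:
  assumes "exchangeable_copula_family c" "1 \<le> m"
  shows "c m \<in> borel_measurable (\<Pi>\<^sub>M j\<in>{1..m}. borel)"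
  using assms by (simp add: exchangeable_copula_family_def copula_density_def)

lemma exchangeable_copula_family_nonneg:
  assumes "exchangeable_copula_family c" "1 \<le> m"
  shows "0 \<le> c m w"
  using assms by (simp add: exchangeable_copula_family_def copula_density_def)

lemma space_copula_scores: "copula_scores c m r \<in> space (\<Pi>\<^sub>M j\<in>{1..m}. borel)"
  by (simp add: copula_scores_def space_PiM)

lemma measurable_fun_upd_Suc:
  assumes "f \<in> measurable M (\<Pi>\<^sub>M j\<in>{1..m}. L)" "h \<in> measurable M L"
  shows "(\<lambda>x. (f x)(Suc m := h x)) \<in> measurable M (\<Pi>\<^sub>M j\<in>{1..Suc m}. L)"
  using assms by (intro measurable_fun_upd[where J="{1..m}"]) auto

lemma measurable_copula_scores:
  assumes c2: "copula2_density c2"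
  shows "copula_scores c2 m \<in> measurable (\<Pi>\<^sub>M j\<in>{1..m}. borel \<Otimes>\<^sub>M borel) (\<Pi>\<^sub>M j\<in>{1..m}. borel)"
proof -
  note [measurable] = borel_measurable_cdf_cond_law[OF c2]
  have "(\<lambda>r. cdf (cond_law c2 (fst (r j))) (snd (r j))) \<in> borel_measurable (\<Pi>\<^sub>M j\<in>{1..m}. borel \<Otimes>\<^sub>M borel)"
    if "j \<in> {1..m}" for j
  proof -
    have "(\<lambda>z. case_prod (\<lambda>u v. cdf (cond_law c2 u) v) z) \<in> borel_measurable (borel \<Otimes>\<^sub>M borel)"
      by measurable
    from measurable_compose[OF measurable_component_singleton[OF that] this]
    show ?thesis by (simp add: case_prod_beta')
  qed
  then have "(\<lambda>r. \<lambda>j\<in>{1..m}. cdf (cond_law c2 (fst (r j))) (snd (r j))) \<in> measurable (\<Pi>\<^sub>M j\<in>{1..m}. borel \<Otimes>\<^sub>M borel) (\<Pi>\<^sub>M j\<in>{1..m}. borel)"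
    by (intro measurable_restrict)
  then show ?thesis by (simp add: copula_scores_def[abs_def])
qed

context
  fixes c2 :: "real \<Rightarrow> real \<Rightarrow> real" and c3 :: "nat \<Rightarrow> (nat \<Rightarrow> real) \<Rightarrow> real" and m :: nat
  assumes c2: "copula2_density c2" and c3: "exchangeable_copula_family c3" and m: "1 \<le> m"
begin

lemma measurable_copula_cond_density:
  "case_prod (copula_cond_density c2 c3 m) \<in>
     borel_measurable ((borel \<Otimes>\<^sub>M (\<Pi>\<^sub>M j\<in>{1..m}. borel \<Otimes>\<^sub>M borel)) \<Otimes>\<^sub>M borel)" (is "_ \<in> borel_measurable ?N")
proof -
  note [measurable] = borel_measurable_cdf_cond_law[OF c2] copula2_density_measurable[OF c2]
  have H: "(\<lambda>p. cdf (cond_law c2 (fst (fst p))) (snd p)) \<in> borel_measurable ?N"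
  proof -
    have "(\<lambda>p. case_prod (\<lambda>u v. cdf (cond_law c2 u) v) (fst (fst p), snd p)) \<in> borel_measurable ?N"
      by measurable
    then show ?thesis by simp
  qed
  have S: "(\<lambda>p. copula_scores c2 m (snd (fst p))) \<in> measurable ?N (\<Pi>\<^sub>M j\<in>{1..m}. borel)"
    by (rule measurable_compose[OF _ measurable_copula_scores[OF c2]]) measurable
  have [measurable]: "(\<lambda>p. c3 (Suc m) ((copula_scores c2 m (snd (fst p)))(Suc m := cdf (cond_law c2 (fst (fst p))) (snd p)))) \<in> borel_measurable ?N"
    by (rule measurable_compose[OF measurable_fun_upd_Suc[OF S H] exchangeable_copula_family_measurable[OF c3]]) simp
  have [measurable]: "(\<lambda>p. c3 m (copula_scores c2 m (snd (fst p)))) \<in> borel_measurable ?N"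
    by (rule measurable_compose[OF S exchangeable_copula_family_measurable[OF c3 m]])
  show ?thesis
    unfolding copula_cond_density_def case_prod_beta' by measurable
qed

lemma copula_cond_density_nonneg: "0 \<le> copula_cond_density c2 c3 m x v"
  unfolding copula_cond_density_def
  by (intro mult_nonneg_nonneg divide_nonneg_nonneg copula2_density_nonneg[OF c2] exchangeable_copula_family_nonneg[OF c3] m) simp

text \<open>Here b is the part of the joint density that depends on v. Substituting t = C_{2|1}(v|u)
  and applying the margin identity r, its integral is \<open>c3 m\<close> at the scores, the
  denominator of the conditional density. Keeping that integral as a factor on the right makes the
  identity valid even when it is 0.\<close>

lemma copula_cond_density_balance:
  assumes u: "cond_law_regular c2 u"
    and r: "(\<integral>\<^sup>+t. ennreal (c3 (Suc m) ((copula_scores c2 m r)(Suc m := t))) \<partial>unif01) = ennreal (c3 m (copula_scores c2 m r))"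
    and \<theta>[measurable]: "\<theta> \<in> borel_measurable borel"
  defines "b \<equiv> (\<lambda>v. ennreal (c2 u v * c3 (Suc m) ((copula_scores c2 m r)(Suc m := cdf (cond_law c2 u) v))))"
  shows "(\<integral>\<^sup>+v. b v * \<theta> v \<partial>unif01) =
    (\<integral>\<^sup>+v. b v \<partial>unif01) * (\<integral>\<^sup>+v. \<theta> v * ennreal (copula_cond_density c2 c3 m (u, r) v) \<partial>unif01)"
proof -
  interpret u: atomless_real_distribution "cond_law c2 u" using u by (simp add: cond_law_regular_def)
  let ?S = "copula_scores c2 m r" and ?H = "cdf (cond_law c2 u)"
  have H: "?H \<in> borel_measurable borel"
    by (intro borel_measurable_mono monoI u.cdf_nondecreasing)
  have cu: "c2 u \<in> borel_measurable borel" by (rule copula2_density_measurable1[OF c2])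
  have k: "(\<lambda>t. c3 (Suc m) (?S(Suc m := t))) \<in> borel_measurable borel"
    by (rule measurable_compose[OF measurable_fun_upd_Suc[OF measurable_const[OF space_copula_scores]] exchangeable_copula_family_measurable[OF c3]]) simp_all
  have kH: "(\<lambda>v. c3 (Suc m) (?S(Suc m := ?H v))) \<in> borel_measurable borel"
    by (rule measurable_compose[OF H k])
  have [measurable]: "b \<in> borel_measurable borel"
    unfolding b_def using cu kH by measurable
  have nn: "0 \<le> c3 (Suc m) w" "0 \<le> c3 m w" for w
    using exchangeable_copula_family_nonneg[OF c3] m by simp_all
  have "(\<integral>\<^sup>+v. b v \<partial>unif01) = (\<integral>\<^sup>+v. ennreal (c2 u v) * ennreal (c3 (Suc m) (?S(Suc m := ?H v))) \<partial>unif01)"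
    unfolding b_def by (intro nn_integral_cong) (simp add: ennreal_mult copula2_density_nonneg[OF c2] nn)
  also have "\<dots> = (\<integral>\<^sup>+v. ennreal (c3 (Suc m) (?S(Suc m := ?H v))) \<partial>cond_law c2 u)"
  proof (subst (2) cond_law_def, subst nn_integral_density)
    show "(\<lambda>s. ennreal (c2 u s)) \<in> borel_measurable unif01"
      using cu by (simp add: measurable_cong_sets[of unif01 borel borel borel])
    show "(\<lambda>v. ennreal (c3 (Suc m) (?S(Suc m := ?H v)))) \<in> borel_measurable unif01"
      using kH by (simp add: measurable_cong_sets[of unif01 borel borel borel])
  qed (rule refl)
  also have "\<dots> = (\<integral>\<^sup>+t. ennreal (c3 (Suc m) (?S(Suc m := t))) \<partial>distr (cond_law c2 u) borel ?H)"
    using H k by (subst nn_integral_distr) auto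
  also have "\<dots> = ennreal (c3 m ?S)" unfolding u.distr_cdf by (rule r)
  finally have b: "(\<integral>\<^sup>+v. b v \<partial>unif01) = ennreal (c3 m ?S)" .
  have bm: "b \<in> borel_measurable unif01" by (simp add: measurable_cong_sets[of unif01 borel borel borel])
  have \<theta>m: "\<theta> \<in> borel_measurable unif01" by (simp add: measurable_cong_sets[of unif01 borel borel borel])
  show ?thesis
  proof (cases "c3 m ?S = 0")
    \<comment> \<open>A nonnegative b with integral 0 vanishes almost everywhere, so both sides are
      0 whatever the quotient means here.\<close>
    case True
    then have "AE v in unif01. b v = 0" using b bm by (simp add: nn_integral_0_iff_AE)
    then have "AE v in unif01. b v * \<theta> v = 0" by eventually_elim simp
    then have "(\<integral>\<^sup>+v. b v * \<theta> v \<partial>unif01) = (\<integral>\<^sup>+v. 0 \<partial>unif01)" by (rule nn_integral_cong_AE)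
    then show ?thesis using b True by simp
  next
    case False
    then have pos: "0 < c3 m ?S" using nn(2)[of ?S] by simp
    have "ennreal (c3 m ?S) * (\<integral>\<^sup>+v. \<theta> v * ennreal (copula_cond_density c2 c3 m (u, r) v) \<partial>unif01)
        = (\<integral>\<^sup>+v. ennreal (c3 m ?S) * ((b v * \<theta> v) * ennreal (1 / c3 m ?S)) \<partial>unif01)"
    proof (subst nn_integral_cmult[symmetric])
      have "\<theta> v * ennreal (copula_cond_density c2 c3 m (u, r) v) = (b v * \<theta> v) * ennreal (1 / c3 m ?S)" for v
      proof -
        have "ennreal (copula_cond_density c2 c3 m (u, r) v) = b v * ennreal (1 / c3 m ?S)"
          unfolding b_def copula_cond_density_def using pos
          by (subst ennreal_mult'[symmetric]) (auto simp: copula2_density_nonneg[OF c2] nn)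
        then show ?thesis by (simp add: ac_simps)
      qed
      then show "(\<lambda>v. \<theta> v * ennreal (copula_cond_density c2 c3 m (u, r) v)) \<in> borel_measurable unif01"
        "(\<integral>\<^sup>+v. ennreal (c3 m ?S) * (\<theta> v * ennreal (copula_cond_density c2 c3 m (u, r) v)) \<partial>unif01)
          = (\<integral>\<^sup>+v. ennreal (c3 m ?S) * ((b v * \<theta> v) * ennreal (1 / c3 m ?S)) \<partial>unif01)"
        using bm \<theta>m by simp_all
    qed
    also have "\<dots> = (\<integral>\<^sup>+v. b v * \<theta> v \<partial>unif01)"
    proof (rule nn_integral_cong)
      fix v
      have "ennreal (c3 m ?S) * ((b v * \<theta> v) * ennreal (1 / c3 m ?S)) = (ennreal (c3 m ?S) * ennreal (1 / c3 m ?S)) * (b v * \<theta> v)"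
        by (simp add: ac_simps)
      also have "ennreal (c3 m ?S) * ennreal (1 / c3 m ?S) = 1"
        using pos by (subst ennreal_mult[symmetric]) auto
      finally show "ennreal (c3 m ?S) * ((b v * \<theta> v) * ennreal (1 / c3 m ?S)) = b v * \<theta> v" by simp
    qed
    finally show ?thesis unfolding b by simp
  qed
qed

end

lemma sets_PiM_unif01_pair [simp]: "sets (\<Pi>\<^sub>M j\<in>I. unif01 \<Otimes>\<^sub>M unif01) = sets (\<Pi>\<^sub>M j\<in>I. borel \<Otimes>\<^sub>M borel)"
  by (intro sets_PiM_cong sets_pair_measure_cong) auto

text \<open>With the conditioning coordinates fixed, the joint density is a factor free of v_n times
  the b of \<open>copula_cond_density_balance\<close>. Averaging over v_n first therefore allows
  \<Theta> to be replaced by its conditional mean.\<close>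

lemma nn_integral_exch2_copula_density_disintegrate:
  fixes \<Theta> :: "(real \<times> (nat \<Rightarrow> real \<times> real)) \<times> real \<Rightarrow> ennreal"
  assumes c1: "exchangeable_copula_family c1" and c2: "copula2_density c2"
    and c3: "exchangeable_copula_family c3" and m: "1 \<le> m"
    and \<Theta>[measurable]: "\<Theta> \<in> borel_measurable ((borel \<Otimes>\<^sub>M (\<Pi>\<^sub>M j\<in>{1..m}. borel \<Otimes>\<^sub>M borel)) \<Otimes>\<^sub>M borel)"
  defines "P \<equiv> \<Pi>\<^sub>M j\<in>{1..Suc m}. unif01 \<Otimes>\<^sub>M unif01"
    and "\<pi> \<equiv> (\<lambda>p. (fst (p (Suc m)), restrict p {1..m}))"
  shows "(\<integral>\<^sup>+p. ennreal (exch2_copula_density (Suc m) c1 c2 c3 p) * \<Theta> (\<pi> p, snd (p (Suc m))) \<partial>P) =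
    (\<integral>\<^sup>+p. ennreal (exch2_copula_density (Suc m) c1 c2 c3 p) *
        (\<integral>\<^sup>+v. \<Theta> (\<pi> p, v) * ennreal (copula_cond_density c2 c3 m (\<pi> p) v) \<partial>unif01) \<partial>P)"
proof -
  interpret U: prob_space unif01 by (rule prob_space_unif01)
  interpret UU: pair_prob_space unif01 unif01 ..
  interpret Q: product_prob_space "\<lambda>_::nat. unif01 \<Otimes>\<^sub>M unif01" by unfold_locales
  let ?H = "\<lambda>u v. cdf (cond_law c2 u) v"
  let ?N = "borel \<Otimes>\<^sub>M (\<Pi>\<^sub>M j\<in>{1..m}. (borel :: real measure) \<Otimes>\<^sub>M (borel :: real measure))"
  have ins: "{1..Suc m} = insert (Suc m) {1..m}" using m by auto
  note cm[measurable] = copula2_density_measurable[OF c2]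
  note Hm[measurable] = borel_measurable_cdf_cond_law[OF c2]
  note km[measurable] = measurable_copula_cond_density[OF c2 c3 m]
  define \<kappa> where "\<kappa> = (\<lambda>x. \<integral>\<^sup>+v. \<Theta> (x, v) * ennreal (copula_cond_density c2 c3 m x v) \<partial>unif01)"
  have \<kappa>[measurable]: "\<kappa> \<in> borel_measurable ?N"
  proof -
    have "(\<lambda>p. \<Theta> p * ennreal (case_prod (copula_cond_density c2 c3 m) p)) \<in> borel_measurable (?N \<Otimes>\<^sub>M borel)"
      by measurable
    then have "(\<lambda>p. \<Theta> p * ennreal (case_prod (copula_cond_density c2 c3 m) p)) \<in> borel_measurable (?N \<Otimes>\<^sub>M unif01)"
      by (simp cong: sets_pair_measure_cong measurable_cong_sets)
    from U.borel_measurable_nn_integral_fst[OF this] show ?thesis by (simp add: \<kappa>_def)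
  qed
  \<comment> \<open>A measurable version of the joint density, equal to it wherever all u_j are
    regular.\<close>
  define D where "D = (\<lambda>p. c1 (Suc m) (\<lambda>j\<in>{1..Suc m}. fst (p j)) * (\<Prod>j=1..Suc m. c2 (fst (p j)) (snd (p j))) *
     c3 (Suc m) (\<lambda>j\<in>{1..Suc m}. ?H (fst (p j)) (snd (p j))))"
  have sP: "sets P = sets (\<Pi>\<^sub>M j\<in>{1..Suc m}. borel \<Otimes>\<^sub>M borel)"
    unfolding P_def by simp
  have D[measurable]: "D \<in> borel_measurable P"
  proof -
    have "(\<lambda>p. \<lambda>j\<in>{1..Suc m}. fst (p j)) \<in> measurable (\<Pi>\<^sub>M j\<in>{1..Suc m}. (borel :: real measure) \<Otimes>\<^sub>M (borel :: real measure)) (\<Pi>\<^sub>M j\<in>{1..Suc m}. borel)"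
      by (intro measurable_restrict) measurable
    from measurable_compose[OF this exchangeable_copula_family_measurable[OF c1]]
    have [measurable]: "(\<lambda>p :: nat \<Rightarrow> real \<times> real. c1 (Suc m) (\<lambda>j\<in>{1..Suc m}. fst (p j))) \<in> borel_measurable (\<Pi>\<^sub>M j\<in>{1..Suc m}. borel \<Otimes>\<^sub>M borel)"
      by simp
    have "1 \<le> Suc m" by simp
    from measurable_compose[OF measurable_copula_scores[OF c2, of "Suc m", unfolded copula_scores_def[abs_def]] exchangeable_copula_family_measurable[OF c3 this]]
    have [measurable]: "(\<lambda>p. c3 (Suc m) (\<lambda>j\<in>{1..Suc m}. ?H (fst (p j)) (snd (p j)))) \<in> borel_measurable (\<Pi>\<^sub>M j\<in>{1..Suc m}. borel \<Otimes>\<^sub>M borel)"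
      using c3 m by simp
    have "(\<lambda>p. case_prod c2 (p j)) \<in> borel_measurable (\<Pi>\<^sub>M j\<in>{1..Suc m}. borel \<Otimes>\<^sub>M borel)" if "j \<in> {1..Suc m}" for j
      by (rule measurable_compose[OF measurable_component_singleton[OF that] cm])
    then have [measurable]: "(\<lambda>p. \<Prod>j=1..Suc m. c2 (fst (p j)) (snd (p j))) \<in> borel_measurable (\<Pi>\<^sub>M j\<in>{1..Suc m}. borel \<Otimes>\<^sub>M borel)"
      by (intro borel_measurable_prod) (simp add: case_prod_beta')
    have "D \<in> borel_measurable (\<Pi>\<^sub>M j\<in>{1..Suc m}. borel \<Otimes>\<^sub>M borel)"
      unfolding D_def by measurable
    then show ?thesis by (simp add: measurable_cong_sets[OF sP refl])
  qed
  have "AE u in distr (unif01 \<Otimes>\<^sub>M unif01) unif01 fst. cond_law_regular c2 u"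
    unfolding U.distr_pair_fst by (rule AE_cond_law_regular[OF c2])
  from AE_distrD[OF measurable_fst this] have "AE p in P. \<forall>j\<in>{1..Suc m}. cond_law_regular c2 (fst (p j))"
    unfolding P_def by (intro AE_ball_countable[THEN iffD2] ballI AE_PiM_component) (auto intro: UU.prob_space_axioms)
  then have DD: "AE p in P. exch2_copula_density (Suc m) c1 c2 c3 p = D p"
  proof eventually_elim
    case (elim p)
    have "(\<lambda>j\<in>{1..Suc m}. copula2_cond_cdf c2 (snd (p j)) (fst (p j))) = (\<lambda>j\<in>{1..Suc m}. ?H (fst (p j)) (snd (p j)))"
      using elim by (intro restrict_ext) (auto simp: cond_law_regular_def)
    then show ?case by (simp add: exch2_copula_density_def D_def)
  qed
  have \<pi>[measurable]: "\<pi> \<in> measurable P ?N"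
  proof -
    have "\<pi> \<in> measurable (\<Pi>\<^sub>M j\<in>{1..Suc m}. borel \<Otimes>\<^sub>M borel) ?N"
      unfolding \<pi>_def using ins by (intro measurable_Pair measurable_restrict_subset) auto
    then show ?thesis by (simp add: measurable_cong_sets[OF sP refl])
  qed
  have vm[measurable]: "(\<lambda>p. snd (p (Suc m))) \<in> borel_measurable P"
  proof -
    have "(\<lambda>p. snd (p (Suc m))) \<in> borel_measurable (\<Pi>\<^sub>M j\<in>{1..Suc m}. (borel :: real measure) \<Otimes>\<^sub>M (borel :: real measure))"
      by measurable
    then show ?thesis by (simp add: measurable_cong_sets[OF sP refl])
  qed
  \<comment> \<open>Tonelli in the order needed: the last coordinate is peeled off the product, then
    separated into u and v, with v innermost.\<close>
  have split: "(\<integral>\<^sup>+p. ennreal (D p) * \<Psi> (\<pi> p, snd (p (Suc m))) \<partial>P) =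
     (\<integral>\<^sup>+r. \<integral>\<^sup>+u. \<integral>\<^sup>+v. ennreal (D (r(Suc m := (u, v)))) * \<Psi> ((u, r), v) \<partial>unif01 \<partial>unif01 \<partial>(\<Pi>\<^sub>M j\<in>{1..m}. unif01 \<Otimes>\<^sub>M unif01))"
    if \<Psi>[measurable]: "\<Psi> \<in> borel_measurable (?N \<Otimes>\<^sub>M borel)" for \<Psi>
  proof -
    have "(\<lambda>p. ennreal (D p) * \<Psi> (\<pi> p, snd (p (Suc m)))) \<in> borel_measurable P" by measurable
    then have meas: "(\<lambda>p. ennreal (D p) * \<Psi> (\<pi> p, snd (p (Suc m)))) \<in> borel_measurable (\<Pi>\<^sub>M j\<in>insert (Suc m) {1..m}. unif01 \<Otimes>\<^sub>M unif01)"
      unfolding P_def ins .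
    have "(\<integral>\<^sup>+p. ennreal (D p) * \<Psi> (\<pi> p, snd (p (Suc m))) \<partial>P) =
      (\<integral>\<^sup>+r. \<integral>\<^sup>+z. ennreal (D (r(Suc m := z))) * \<Psi> (\<pi> (r(Suc m := z)), snd ((r(Suc m := z)) (Suc m))) \<partial>(unif01 \<Otimes>\<^sub>M unif01) \<partial>(\<Pi>\<^sub>M j\<in>{1..m}. unif01 \<Otimes>\<^sub>M unif01))"
      unfolding P_def ins by (rule Q.product_nn_integral_insert[OF _ _ meas]) auto
    also have "\<dots> = (\<integral>\<^sup>+r. \<integral>\<^sup>+u. \<integral>\<^sup>+v. ennreal (D (r(Suc m := (u, v)))) * \<Psi> ((u, r), v) \<partial>unif01 \<partial>unif01 \<partial>(\<Pi>\<^sub>M j\<in>{1..m}. unif01 \<Otimes>\<^sub>M unif01))"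
    proof (rule nn_integral_cong)
      fix r assume r: "r \<in> space (\<Pi>\<^sub>M j\<in>{1..m}. unif01 \<Otimes>\<^sub>M unif01)"
      have re: "restrict (r(Suc m := z)) {1..m} = r" for z
        using r by (auto simp: space_PiM PiE_def extensional_def restrict_def fun_eq_iff)
      have re': "restrict r {1..m} = r"
        using r by (auto simp: space_PiM PiE_def extensional_def restrict_def fun_eq_iff)
      have mr: "(\<lambda>z. ennreal (D (r(Suc m := z))) * \<Psi> (\<pi> (r(Suc m := z)), snd ((r(Suc m := z)) (Suc m)))) \<in> borel_measurable (unif01 \<Otimes>\<^sub>M unif01)"
        using measurable_compose[OF measurable_component_update[OF r] meas] by simp
      show "(\<integral>\<^sup>+z. ennreal (D (r(Suc m := z))) * \<Psi> (\<pi> (r(Suc m := z)), snd ((r(Suc m := z)) (Suc m))) \<partial>(unif01 \<Otimes>\<^sub>M unif01))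
        = (\<integral>\<^sup>+u. \<integral>\<^sup>+v. ennreal (D (r(Suc m := (u, v)))) * \<Psi> ((u, r), v) \<partial>unif01 \<partial>unif01)"
        by (subst U.nn_integral_fst[OF mr, symmetric]) (simp add: \<pi>_def re re' del: One_nat_def)
    qed
    finally show ?thesis .
  qed
  \<comment> \<open>The margin identity at the scores of the earlier pairs; it may fail on a set of
    positive measure, but only where some c2 factor vanishes.\<close>
  have "AE r in (\<Pi>\<^sub>M j\<in>{1..m}. unif01 \<Otimes>\<^sub>M unif01). (\<Prod>j\<in>{1..m}. c2 (fst (r j)) (snd (r j))) \<noteq> 0 \<longrightarrow>
     (\<integral>\<^sup>+t. ennreal (c3 (Suc m) ((copula_scores c2 m r)(Suc m := t))) \<partial>unif01) = ennreal (c3 m (copula_scores c2 m r))"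
    unfolding copula_scores_def by (rule AE_PiM_cond_cdf[OF c2 _ AE_exchangeable_margin[OF c3 m]]) simp
  then have eq: "AE r in (\<Pi>\<^sub>M j\<in>{1..m}. unif01 \<Otimes>\<^sub>M unif01).
     (\<integral>\<^sup>+u. \<integral>\<^sup>+v. ennreal (D (r(Suc m := (u, v)))) * \<Theta> ((u, r), v) \<partial>unif01 \<partial>unif01) =
     (\<integral>\<^sup>+u. \<integral>\<^sup>+v. ennreal (D (r(Suc m := (u, v)))) * \<kappa> (u, r) \<partial>unif01 \<partial>unif01)"
    using AE_space
  proof eventually_elim
    case (elim r)
    let ?S = "copula_scores c2 m r"
    \<comment> \<open>a collects everything free of v, in particular the whole c1 factor; b is the
      rest.\<close>
    define a where "a = (\<lambda>u. c1 (Suc m) ((\<lambda>j\<in>{1..m}. fst (r j))(Suc m := u)) * (\<Prod>j\<in>{1..m}. c2 (fst (r j)) (snd (r j))))"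
    define b where "b = (\<lambda>u v. c2 u v * c3 (Suc m) (?S(Suc m := ?H u v)))"
    have nn: "0 \<le> c3 (Suc m) w" "0 \<le> c1 (Suc m) w" for w
      using exchangeable_copula_family_nonneg[OF c3] exchangeable_copula_family_nonneg[OF c1] m by simp_all
    have a0: "0 \<le> a u" for u unfolding a_def
      by (intro mult_nonneg_nonneg nn prod_nonneg) (simp add: copula2_density_nonneg[OF c2])
    have b0: "0 \<le> b u v" for u v unfolding b_def
      by (intro mult_nonneg_nonneg nn copula2_density_nonneg[OF c2])
    have Dab: "ennreal (D (r(Suc m := (u, v)))) = ennreal (a u) * ennreal (b u v)" for u v
    proof -
      have "(\<lambda>j\<in>{1..Suc m}. fst ((r(Suc m := (u, v))) j)) = (\<lambda>j\<in>{1..m}. fst (r j))(Suc m := u)"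
        by (auto simp: fun_eq_iff restrict_def)
      moreover have "(\<lambda>j\<in>{1..Suc m}. ?H (fst ((r(Suc m := (u, v))) j)) (snd ((r(Suc m := (u, v))) j))) = ?S(Suc m := ?H u v)"
        by (auto simp: fun_eq_iff restrict_def copula_scores_def)
      moreover have "(\<Prod>j=1..Suc m. c2 (fst ((r(Suc m := (u, v))) j)) (snd ((r(Suc m := (u, v))) j))) = (\<Prod>j\<in>{1..m}. c2 (fst (r j)) (snd (r j))) * c2 u v"
        unfolding ins by (subst prod.insert) (auto simp: mult.commute intro!: prod.cong)
      ultimately have "D (r(Suc m := (u, v))) = a u * b u v"
        unfolding D_def a_def b_def by (simp only: ac_simps)
      then show ?thesis using a0 b0 by (simp add: ennreal_mult)
    qed
    have bm: "(\<lambda>v. ennreal (b u v)) \<in> borel_measurable unif01" if "cond_law_regular c2 u" for u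
    proof -
      interpret u: atomless_real_distribution "cond_law c2 u" using that by (simp add: cond_law_regular_def)
      have H: "?H u \<in> borel_measurable borel"
        by (intro borel_measurable_mono monoI u.cdf_nondecreasing)
      have k: "(\<lambda>t. c3 (Suc m) (?S(Suc m := ?H u t))) \<in> borel_measurable borel"
        by (rule measurable_compose[OF measurable_fun_upd_Suc[OF measurable_const[OF space_copula_scores] H] exchangeable_copula_family_measurable[OF c3]]) simp_all
      have "(\<lambda>v. ennreal (b u v)) \<in> borel_measurable borel"
        unfolding b_def using copula2_density_measurable1[OF c2, of u] k by measurable
      then show ?thesis by (simp add: measurable_cong_sets[of unif01 borel borel borel])
    qed
    have \<Theta>m: "(\<lambda>v. \<Theta> ((u, r), v)) \<in> borel_measurable borel" for u
    proof -
      have "r \<in> space (\<Pi>\<^sub>M j\<in>{1..m}. (borel :: real measure) \<Otimes>\<^sub>M (borel :: real measure))"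
        using elim(2) by (simp add: space_PiM space_pair_measure)
      then have "(u, r) \<in> space ?N" by (simp add: space_pair_measure)
      then show ?thesis by measurable
    qed
    have \<Theta>m': "(\<lambda>v. \<Theta> ((u, r), v)) \<in> borel_measurable unif01" for u
      using \<Theta>m by (simp add: measurable_cong_sets[of unif01 borel borel borel])
    show ?case
    proof (rule nn_integral_cong_AE)
      show "AE u in unif01. (\<integral>\<^sup>+v. ennreal (D (r(Suc m := (u, v)))) * \<Theta> ((u, r), v) \<partial>unif01)
         = (\<integral>\<^sup>+v. ennreal (D (r(Suc m := (u, v)))) * \<kappa> (u, r) \<partial>unif01)"
        using AE_cond_law_regular[OF c2]
      proof eventually_elim
        fix u assume u: "cond_law_regular c2 u"
        have L: "(\<integral>\<^sup>+v. ennreal (D (r(Suc m := (u, v)))) * \<Theta> ((u, r), v) \<partial>unif01) = ennreal (a u) * (\<integral>\<^sup>+v. ennreal (b u v) * \<Theta> ((u, r), v) \<partial>unif01)"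
          unfolding Dab mult.assoc by (intro nn_integral_cmult borel_measurable_times_ennreal bm[OF u] \<Theta>m')
        have R: "(\<integral>\<^sup>+v. ennreal (D (r(Suc m := (u, v)))) * \<kappa> (u, r) \<partial>unif01) = ennreal (a u) * ((\<integral>\<^sup>+v. ennreal (b u v) \<partial>unif01) * \<kappa> (u, r))"
          unfolding Dab mult.assoc using bm[OF u] by (subst nn_integral_cmult) (auto simp: nn_integral_multc)
        show "(\<integral>\<^sup>+v. ennreal (D (r(Suc m := (u, v)))) * \<Theta> ((u, r), v) \<partial>unif01)
         = (\<integral>\<^sup>+v. ennreal (D (r(Suc m := (u, v)))) * \<kappa> (u, r) \<partial>unif01)"
        \<comment> \<open>A vanishing c2 factor kills a, hence both sides; otherwise the margin
          identity is available for these scores.\<close>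
        proof (cases "(\<Prod>j\<in>{1..m}. c2 (fst (r j)) (snd (r j))) = 0")
          case True
          then have "a u = 0" unfolding a_def by simp
          then show ?thesis unfolding L R by simp
        next
          case False
          then have "(\<integral>\<^sup>+t. ennreal (c3 (Suc m) (?S(Suc m := t))) \<partial>unif01) = ennreal (c3 m ?S)"
            using elim(1) by blast
          from copula_cond_density_balance[OF c2 c3 m u this \<Theta>m[of u]]
          show ?thesis unfolding L R unfolding b_def \<kappa>_def by (rule arg_cong)
        qed
      qed
    qed
  qed
  have "(\<integral>\<^sup>+p. ennreal (exch2_copula_density (Suc m) c1 c2 c3 p) * \<Theta> (\<pi> p, snd (p (Suc m))) \<partial>P) =
    (\<integral>\<^sup>+p. ennreal (D p) * \<Theta> (\<pi> p, snd (p (Suc m))) \<partial>P)"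
    by (rule nn_integral_cong_AE) (use DD in eventually_elim, simp)
  also have "\<dots> = (\<integral>\<^sup>+p. ennreal (D p) * \<kappa> (\<pi> p) \<partial>P)"
    using split[OF \<Theta>] split[OF measurable_compose[OF measurable_fst \<kappa>]] nn_integral_cong_AE[OF eq]
    by (simp only: fst_conv)
  also have "\<dots> = (\<integral>\<^sup>+p. ennreal (exch2_copula_density (Suc m) c1 c2 c3 p) * \<kappa> (\<pi> p) \<partial>P)"
    by (rule nn_integral_cong_AE) (use DD in eventually_elim, simp)
  finally show ?thesis unfolding \<kappa>_def .
qed


section \<open>Transfer to the original variables\<close>

lemma distributed_lborel_atomless:
  assumes "prob_space M" and T: "distributed M lborel T h"
  shows "distr M borel T = density lborel h" and "atomless_real_distribution (distr M borel T)"
proof -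
  interpret prob_space M by fact
  have [measurable]: "T \<in> borel_measurable M"
    using distributed_measurable[OF T] by simp
  have [measurable]: "h \<in> borel_measurable borel"
    using distributed_borel_measurable[OF T] by simp
  have "distr M borel T = distr M lborel T" by (intro distr_cong) auto
  then show d: "distr M borel T = density lborel h"
    using distributed_distr_eq_density[OF T] by simp
  interpret T: real_distribution "distr M borel T" by simp
  have "emeasure (density lborel h) {x} = 0" for x
  proof -
    have "AE s in lborel. s \<noteq> x" by (rule AE_lborel_singleton)
    then have "AE s in density lborel h. s \<noteq> x" by (subst AE_density) auto
    then show ?thesis by (subst (asm) AE_iff_measurable[OF _ refl]) auto
  qed
  then have "emeasure (distr M borel T) {x} = 0" for x by (simp only: d)
  then show "atomless_real_distribution (distr M borel T)"
    by unfold_locales (simp add: measure_def)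
qed

text \<open>The model fixes only the law of the (F(X_j), G(Y_j)). Since the quantile functions
  recover the X_j and Y_j almost surely, \<Theta> can be read as a test function on the cube,
  disintegrated there and carried back.\<close>

theorem exch2_copula_model_joint_law:
  fixes \<Theta> :: "(real \<times> (nat \<Rightarrow> real \<times> real)) \<times> real \<Rightarrow> ennreal"
  assumes m: "1 \<le> m" and model: "exch2_copula_model M (Suc m) X Y F f G g c1 c2 c3"
    and \<Theta>[measurable]: "\<Theta> \<in> borel_measurable ((borel \<Otimes>\<^sub>M (\<Pi>\<^sub>M j\<in>{1..m}. borel \<Otimes>\<^sub>M borel)) \<Otimes>\<^sub>M borel)"
  defines "Z \<equiv> (\<lambda>\<omega>. (X (Suc m) \<omega>, \<lambda>j\<in>{1..m}. (X j \<omega>, Y j \<omega>)))"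
    and "\<tau> \<equiv> (\<lambda>z. (F (fst z), \<lambda>j\<in>{1..m}. (F (fst (snd z j)), G (snd (snd z j)))))"
  shows "(\<integral>\<^sup>+\<omega>. \<Theta> (Z \<omega>, Y (Suc m) \<omega>) \<partial>M) =
    (\<integral>\<^sup>+\<omega>. \<integral>\<^sup>+y. \<Theta> (Z \<omega>, y) * ennreal (g y * copula_cond_density c2 c3 m (\<tau> (Z \<omega>)) (G y)) \<partial>lborel \<partial>M)"
proof -
  let ?n = "Suc m"
  let ?N = "borel \<Otimes>\<^sub>M (\<Pi>\<^sub>M j\<in>{1..m}. (borel :: real measure) \<Otimes>\<^sub>M (borel :: real measure))"
  have M: "prob_space M" and g0: "\<And>y. 0 \<le> g y"
    and X: "\<And>j. j \<in> {1..?n} \<Longrightarrow> distributed M lborel (X j) (\<lambda>x. ennreal (f x))"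
    and F: "\<And>j. j \<in> {1..?n} \<Longrightarrow> cdf (distr M borel (X j)) = F"
    and Y: "\<And>j. j \<in> {1..?n} \<Longrightarrow> distributed M lborel (Y j) (\<lambda>y. ennreal (g y))"
    and G: "\<And>j. j \<in> {1..?n} \<Longrightarrow> cdf (distr M borel (Y j)) = G"
    and c: "exchangeable_copula_family c1" "copula2_density c2" "exchangeable_copula_family c3"
    and UV: "distributed M (\<Pi>\<^sub>M j\<in>{1..?n}. unif01 \<Otimes>\<^sub>M unif01) (\<lambda>\<omega>. \<lambda>j\<in>{1..?n}. (F (X j \<omega>), G (Y j \<omega>)))
       (\<lambda>p. ennreal (exch2_copula_density ?n c1 c2 c3 p))"
    using model by (auto simp: exch2_copula_model_def)
  interpret M: prob_space M by (rule M)
  interpret U: prob_space unif01 by (rule prob_space_unif01)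
  have n: "?n \<in> {1..?n}" by simp
  note km[measurable] = measurable_copula_cond_density[OF c(2,3) m]
  interpret LX: atomless_real_distribution "distr M borel (X ?n)"
    by (rule distributed_lborel_atomless(2)[OF M X[OF n]])
  interpret LY: atomless_real_distribution "distr M borel (Y ?n)"
    by (rule distributed_lborel_atomless(2)[OF M Y[OF n]])
  have F_m[measurable]: "F \<in> borel_measurable borel" and G_m[measurable]: "G \<in> borel_measurable borel"
    using LX.cdf_nondecreasing LY.cdf_nondecreasing unfolding F[OF n] G[OF n]
    by (intro borel_measurable_mono monoI; blast)+
  have QF_m[measurable]: "quantile F \<in> borel_measurable borel" and QG_m[measurable]: "quantile G \<in> borel_measurable borel"
    using LX.borel_measurable_quantile_cdf LY.borel_measurable_quantile_cdf unfolding F[OF n] G[OF n] by auto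
  have X_m: "X j \<in> borel_measurable M" and Y_m: "Y j \<in> borel_measurable M" if "j \<in> {1..?n}" for j
    using distributed_measurable[OF X[OF that]] distributed_measurable[OF Y[OF that]] by simp_all
  note [measurable] = X_m[OF n] Y_m[OF n]
  have g_m[measurable]: "g \<in> borel_measurable borel"
  proof -
    have "(\<lambda>y. enn2real (ennreal (g y))) \<in> borel_measurable borel"
      using distributed_borel_measurable[OF Y[OF n]] by measurable
    then show ?thesis by (simp add: g0)
  qed
  have Z_m[measurable]: "Z \<in> measurable M ?N"
    unfolding Z_def using X_m Y_m by (intro measurable_Pair measurable_restrict) auto
  have pw: "(\<lambda>z. (A (fst z), \<lambda>j\<in>{1..m}. (A (fst (snd z j)), B (snd (snd z j))))) \<in> measurable ?N ?N"
    if [measurable]: "A \<in> borel_measurable borel" "B \<in> borel_measurable borel" for A B :: "real \<Rightarrow> real"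
  proof (intro measurable_Pair measurable_restrict)
    fix j assume j: "j \<in> {1..m}"
    have [measurable]: "(\<lambda>z. snd z j) \<in> measurable ?N (borel \<Otimes>\<^sub>M borel)"
      by (rule measurable_compose[OF measurable_snd measurable_component_singleton[OF j]])
    show "(\<lambda>z. A (fst (snd z j))) \<in> borel_measurable ?N" "(\<lambda>z. B (snd (snd z j))) \<in> borel_measurable ?N"
      by measurable
  qed measurable
  have \<tau>_m[measurable]: "\<tau> \<in> measurable ?N ?N"
    unfolding \<tau>_def by (rule pw) auto
  define q where "q = (\<lambda>z :: real \<times> (nat \<Rightarrow> real \<times> real). (quantile F (fst z), \<lambda>j\<in>{1..m}. (quantile F (fst (snd z j)), quantile G (snd (snd z j)))))"
  have q_m[measurable]: "q \<in> measurable ?N ?N"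
    unfolding q_def by (rule pw) auto
  have AE_X: "AE \<omega> in M. quantile F (F (X j \<omega>)) = X j \<omega>" if j: "j \<in> {1..?n}" for j
  proof -
    interpret L: atomless_real_distribution "distr M borel (X j)"
      by (rule distributed_lborel_atomless(2)[OF M X[OF j]])
    show ?thesis using AE_distrD[OF X_m[OF j] L.AE_quantile_cdf] by (simp add: F[OF j])
  qed
  have AE_Y: "AE \<omega> in M. quantile G (G (Y j \<omega>)) = Y j \<omega>" if j: "j \<in> {1..?n}" for j
  proof -
    interpret L: atomless_real_distribution "distr M borel (Y j)"
      by (rule distributed_lborel_atomless(2)[OF M Y[OF j]])
    show ?thesis using AE_distrD[OF Y_m[OF j] L.AE_quantile_cdf] by (simp add: G[OF j])
  qed
  have "AE \<omega> in M. (\<forall>j\<in>{1..?n}. quantile F (F (X j \<omega>)) = X j \<omega>) \<and> (\<forall>j\<in>{1..?n}. quantile G (G (Y j \<omega>)) = Y j \<omega>)"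
    using AE_X AE_Y by (simp add: AE_ball_countable AE_conj_iff)
  then have inv: "AE \<omega> in M. q (\<tau> (Z \<omega>)) = Z \<omega> \<and> quantile G (G (Y ?n \<omega>)) = Y ?n \<omega>"
    by eventually_elim (auto simp: q_def \<tau>_def Z_def intro!: restrict_ext)
  define UVf where "UVf = (\<lambda>\<omega>. \<lambda>j\<in>{1..?n}. (F (X j \<omega>), G (Y j \<omega>)))"
  define \<pi> where "\<pi> = (\<lambda>p :: nat \<Rightarrow> real \<times> real. (fst (p ?n), restrict p {1..m}))"
  have \<pi>UV: "\<pi> (UVf \<omega>) = \<tau> (Z \<omega>)" "snd (UVf \<omega> ?n) = G (Y ?n \<omega>)" for \<omega>
    by (auto simp: \<pi>_def UVf_def \<tau>_def Z_def fun_eq_iff restrict_def)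
  let ?P = "\<Pi>\<^sub>M j\<in>{1..?n}. unif01 \<Otimes>\<^sub>M unif01"
  \<comment> \<open>\<Theta> seen from the copula scale; almost surely q undoes \<tau>, so along the
    model \<Theta>' reproduces \<Theta>.\<close>
  define \<Theta>' where "\<Theta>' = (\<lambda>(x, v). \<Theta> (q x, quantile G v))"
  have \<Theta>'_m[measurable]: "\<Theta>' \<in> borel_measurable (?N \<Otimes>\<^sub>M borel)"
    unfolding \<Theta>'_def by measurable
  have \<pi>_m: "\<pi> \<in> measurable ?P ?N"
  proof -
    have "{1..m} \<subseteq> {1..?n}" by auto
    then have "\<pi> \<in> measurable (\<Pi>\<^sub>M j\<in>{1..?n}. borel \<Otimes>\<^sub>M borel) ?N"
      unfolding \<pi>_def by (intro measurable_Pair measurable_restrict_subset) auto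
    then show ?thesis by (simp add: measurable_cong_sets[OF sets_PiM_unif01_pair refl])
  qed
  have vm: "(\<lambda>p. snd (p ?n)) \<in> borel_measurable ?P"
  proof -
    have "(\<lambda>p. snd (p ?n)) \<in> borel_measurable (\<Pi>\<^sub>M j\<in>{1..?n}. (borel :: real measure) \<Otimes>\<^sub>M (borel :: real measure))"
      by measurable
    then show ?thesis by (simp add: measurable_cong_sets[OF sets_PiM_unif01_pair refl])
  qed
  define \<kappa> where "\<kappa> = (\<lambda>x. \<integral>\<^sup>+v. \<Theta>' (x, v) * ennreal (copula_cond_density c2 c3 m x v) \<partial>unif01)"
  have \<kappa>_m: "\<kappa> \<in> borel_measurable ?N"
  proof -
    have "(\<lambda>p. \<Theta>' p * ennreal (case_prod (copula_cond_density c2 c3 m) p)) \<in> borel_measurable (?N \<Otimes>\<^sub>M borel)"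
      by measurable
    then have "(\<lambda>p. \<Theta>' p * ennreal (case_prod (copula_cond_density c2 c3 m) p)) \<in> borel_measurable (?N \<Otimes>\<^sub>M unif01)"
      by (simp cong: sets_pair_measure_cong measurable_cong_sets)
    from U.borel_measurable_nn_integral_fst[OF this] show ?thesis by (simp add: \<kappa>_def)
  qed
  have "(\<integral>\<^sup>+\<omega>. \<Theta> (Z \<omega>, Y ?n \<omega>) \<partial>M) = (\<integral>\<^sup>+\<omega>. \<Theta>' (\<pi> (UVf \<omega>), snd (UVf \<omega> ?n)) \<partial>M)"
    by (rule nn_integral_cong_AE) (use inv in eventually_elim, simp add: \<pi>UV \<Theta>'_def)
  also have "\<dots> = (\<integral>\<^sup>+p. ennreal (exch2_copula_density ?n c1 c2 c3 p) * \<Theta>' (\<pi> p, snd (p ?n)) \<partial>?P)"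
    by (rule distributed_nn_integral[OF UV[folded UVf_def], symmetric])
       (intro measurable_compose[OF _ \<Theta>'_m] measurable_Pair \<pi>_m vm)
  also have "\<dots> = (\<integral>\<^sup>+p. ennreal (exch2_copula_density ?n c1 c2 c3 p) * \<kappa> (\<pi> p) \<partial>?P)"
    using nn_integral_exch2_copula_density_disintegrate[OF c m \<Theta>'_m] by (simp only: \<pi>_def \<kappa>_def)
  \<comment> \<open>The law of the copula coordinates is now used in the opposite direction; only
    the conditioning variables are left in the integrand.\<close>
  also have "\<dots> = (\<integral>\<^sup>+\<omega>. \<kappa> (\<pi> (UVf \<omega>)) \<partial>M)"
    by (rule distributed_nn_integral[OF UV[folded UVf_def]]) (rule measurable_compose[OF \<pi>_m \<kappa>_m])
  also have "\<dots> = (\<integral>\<^sup>+\<omega>. \<integral>\<^sup>+y. \<Theta> (Z \<omega>, y) * ennreal (g y * copula_cond_density c2 c3 m (\<tau> (Z \<omega>)) (G y)) \<partial>lborel \<partial>M)"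
  proof (rule nn_integral_cong_AE)
    show "AE \<omega> in M. \<kappa> (\<pi> (UVf \<omega>)) =
      (\<integral>\<^sup>+y. \<Theta> (Z \<omega>, y) * ennreal (g y * copula_cond_density c2 c3 m (\<tau> (Z \<omega>)) (G y)) \<partial>lborel)"
      using inv AE_space
    proof eventually_elim
      case (elim \<omega>)
      let ?k = "copula_cond_density c2 c3 m (\<tau> (Z \<omega>))"
      have ZN: "Z \<omega> \<in> space ?N" by (rule measurable_space[OF Z_m elim(2)])
      have \<tau>N: "\<tau> (Z \<omega>) \<in> space ?N" by (rule measurable_space[OF \<tau>_m ZN])
      have k_m[measurable]: "?k \<in> borel_measurable borel"
        using measurable_compose[OF measurable_Pair1'[OF \<tau>N] km] by simp
      have \<Theta>_s[measurable]: "(\<lambda>y. \<Theta> (Z \<omega>, y)) \<in> borel_measurable borel"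
        by (rule measurable_compose[OF measurable_Pair1'[OF ZN] \<Theta>])
      have LYd: "distr M borel (Y ?n) = density lborel (\<lambda>y. ennreal (g y))"
        by (rule distributed_lborel_atomless(1)[OF M Y[OF n]])
      have "\<kappa> (\<pi> (UVf \<omega>)) = (\<integral>\<^sup>+v. \<Theta> (Z \<omega>, quantile G v) * ennreal (?k v) \<partial>unif01)"
        unfolding \<pi>UV \<kappa>_def \<Theta>'_def using elim by simp
      \<comment> \<open>\<omega> is fixed in the integrand here. The marginal law of Y_n serves only
        to rewrite the uniform variable v as G(y).\<close>
      also have "unif01 = distr (distr M borel (Y ?n)) borel G"
        using LY.distr_cdf unfolding G[OF n] ..
      also have "(\<integral>\<^sup>+v. \<Theta> (Z \<omega>, quantile G v) * ennreal (?k v) \<partial>distr (distr M borel (Y ?n)) borel G) =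
         (\<integral>\<^sup>+y. \<Theta> (Z \<omega>, quantile G (G y)) * ennreal (?k (G y)) \<partial>distr M borel (Y ?n))"
        by (rule nn_integral_distr) (auto intro: measurable_compose[OF QG_m \<Theta>_s])
      also have "\<dots> = (\<integral>\<^sup>+y. \<Theta> (Z \<omega>, y) * ennreal (?k (G y)) \<partial>distr M borel (Y ?n))"
        by (rule nn_integral_cong_AE) (use LY.AE_quantile_cdf[unfolded G[OF n]] in eventually_elim, simp)
      also have "\<dots> = (\<integral>\<^sup>+y. ennreal (g y) * (\<Theta> (Z \<omega>, y) * ennreal (?k (G y))) \<partial>lborel)"
        unfolding LYd by (subst nn_integral_density) auto
      also have "\<dots> = (\<integral>\<^sup>+y. \<Theta> (Z \<omega>, y) * ennreal (g y * ?k (G y)) \<partial>lborel)"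
        by (intro nn_integral_cong) (simp add: ennreal_mult g0 copula_cond_density_nonneg[OF c(2,3) m] ac_simps)
      finally show ?case .
    qed
  qed
  finally show ?thesis .
qed

section \<open>Conditional density and best predictor of Y_n\<close>

text \<open>Almost surely every F(X_j) is a regular point, and there \<open>gP\<close> and
  \<open>eP\<close> coincide with measurable versions to which the joint law and the substitution
  apply. The equality of the y-integral with the t-integral is separate from the predictor formula
  because \<open>real_cond_exp\<close> has its meaning only for integrable variables.\<close>

theorem mainTheorem5:
  fixes M :: "'w measure" and n :: nat
    and X Y :: "nat \<Rightarrow> 'w \<Rightarrow> real"
    and F f G g :: "real \<Rightarrow> real"
    and c1 c3 :: "nat \<Rightarrow> (nat \<Rightarrow> real) \<Rightarrow> real"
    and c2 :: "real \<Rightarrow> real \<Rightarrow> real"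
    and N :: "(real \<times> (nat \<Rightarrow> real \<times> real)) measure"
    and Z :: "'w \<Rightarrow> real \<times> (nat \<Rightarrow> real \<times> real)"
    and w :: "(nat \<Rightarrow> real \<times> real) \<Rightarrow> nat \<Rightarrow> real"
    and gP eP :: "real \<times> (nat \<Rightarrow> real \<times> real) \<Rightarrow> real \<Rightarrow> real"
  assumes n: "n \<ge> 2"
    and model: "exch2_copula_model M n X Y F f G g c1 c2 c3"
    \<comment> \<open>the conditioning variables: \<open>X\<^sub>n\<close> and the pairs \<open>(X\<^sub>j, Y\<^sub>j)\<close> for \<open>j = 1, \<dots>, n - 1\<close>\<close>
    and N: "N = borel \<Otimes>\<^sub>M (\<Pi>\<^sub>M j\<in>{1..n-1}. borel \<Otimes>\<^sub>M borel)"
    and Z: "Z = (\<lambda>\<omega>. (X n \<omega>, \<lambda>j\<in>{1..n-1}. (X j \<omega>, Y j \<omega>)))"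
    and w: "w = (\<lambda>z j. copula2_cond_cdf c2 (G (snd (z j))) (F (fst (z j))))"
    and gP: "gP = (\<lambda>(x, z) y. g y * c2 (F x) (G y) *
              (c3 n (\<lambda>j\<in>{1..n}. if j < n then w z j else copula2_cond_cdf c2 (G y) (F x))
               / c3 (n - 1) (\<lambda>j\<in>{1..n-1}. w z j)))"
    and eP: "eP = (\<lambda>(x, z) t. quantile G (quantile (\<lambda>v. copula2_cond_cdf c2 v (F x)) t) *
              (c3 n (\<lambda>j\<in>{1..n}. if j < n then w z j else t)
               / c3 (n - 1) (\<lambda>j\<in>{1..n-1}. w z j)))"
  shows "conditional_density M N Z (Y n) gP \<and>
         (AE \<omega> in M.
            integrable lborel (\<lambda>y. y * gP (Z \<omega>) y) = set_integrable lborel {0..1} (eP (Z \<omega>)) \<and>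
            (LINT y|lborel. y * gP (Z \<omega>) y) = (LINT t:{0..1}|lborel. eP (Z \<omega>) t)) \<and>
         (integrable M (Y n) \<longrightarrow>
          (AE \<omega> in M.
            set_integrable lborel {0..1} (eP (Z \<omega>)) \<and>
            real_cond_exp M (vimage_algebra (space M) Z N) (Y n) \<omega>
              = (LINT t:{0..1}|lborel. eP (Z \<omega>) t)))"
proof -
  \<comment> \<open>n \<ge> 2 leaves at least one earlier pair, so the denominator c3 (n - 1)
    belongs to the family, which starts at index 1.\<close>
  obtain m where nm: "n = Suc m" and m: "1 \<le> m" using n by (cases n) auto
  have n1: "n - 1 = m" using nm by simp
  have M: "prob_space M" and g0: "\<And>y. 0 \<le> g y"
    and X: "\<And>j. j \<in> {1..n} \<Longrightarrow> distributed M lborel (X j) (\<lambda>x. ennreal (f x))"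
    and F: "\<And>j. j \<in> {1..n} \<Longrightarrow> cdf (distr M borel (X j)) = F"
    and Y: "\<And>j. j \<in> {1..n} \<Longrightarrow> distributed M lborel (Y j) (\<lambda>y. ennreal (g y))"
    and G: "\<And>j. j \<in> {1..n} \<Longrightarrow> cdf (distr M borel (Y j)) = G"
    and c: "copula2_density c2" "exchangeable_copula_family c3"
    using model by (auto simp: exch2_copula_model_def)
  interpret M: prob_space M by (rule M)
  have nn: "n \<in> {1..n}" using n by simp
  have X_m: "X j \<in> borel_measurable M" and Y_m: "Y j \<in> borel_measurable M" if "j \<in> {1..n}" for j
    using distributed_measurable[OF X[OF that]] distributed_measurable[OF Y[OF that]] by simp_all
  have g_m[measurable]: "g \<in> borel_measurable borel"
  proof -
    have "(\<lambda>y. enn2real (ennreal (g y))) \<in> borel_measurable borel"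
      using distributed_borel_measurable[OF Y[OF nn]] by measurable
    then show ?thesis by (simp add: g0)
  qed
  have LY: "atomless_real_distribution (distr M borel (Y n))"
    and LYd: "distr M borel (Y n) = density lborel (\<lambda>y. ennreal (g y))"
    by (rule distributed_lborel_atomless[OF M Y[OF nn]])+
  have LX: "atomless_real_distribution (distr M borel (X j))" if "j \<in> {1..n}" for j
    by (rule distributed_lborel_atomless[OF M X[OF that]])
  interpret LX: atomless_real_distribution "distr M borel (X n)" by (rule LX[OF nn])
  interpret LY: atomless_real_distribution "distr M borel (Y n)" by (rule LY)
  have F_m[measurable]: "F \<in> borel_measurable borel" and G_m[measurable]: "G \<in> borel_measurable borel"
    using LX.cdf_nondecreasing LY.cdf_nondecreasing unfolding F[OF nn] G[OF nn]
    by (intro borel_measurable_mono monoI; blast)+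
  have N': "N = borel \<Otimes>\<^sub>M (\<Pi>\<^sub>M j\<in>{1..m}. borel \<Otimes>\<^sub>M borel)" unfolding N n1 ..
  have Z': "Z = (\<lambda>\<omega>. (X (Suc m) \<omega>, \<lambda>j\<in>{1..m}. (X j \<omega>, Y j \<omega>)))" unfolding Z n1 nm by (simp add: fun_eq_iff)
  have Z_m[measurable]: "Z \<in> measurable M N"
    unfolding Z' N' using X_m Y_m nm by (intro measurable_Pair measurable_restrict) auto
  define \<tau> where "\<tau> = (\<lambda>z :: real \<times> (nat \<Rightarrow> real \<times> real). (F (fst z), \<lambda>j\<in>{1..m}. (F (fst (snd z j)), G (snd (snd z j)))))"
  have \<tau>_m[measurable]: "\<tau> \<in> measurable N N"
    unfolding \<tau>_def N'
  proof (intro measurable_Pair measurable_restrict)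
    fix j assume j: "j \<in> {1..m}"
    have [measurable]: "(\<lambda>z. snd z j) \<in> measurable (borel \<Otimes>\<^sub>M (\<Pi>\<^sub>M j\<in>{1..m}. borel \<Otimes>\<^sub>M borel)) (borel \<Otimes>\<^sub>M borel)"
      by (rule measurable_compose[OF measurable_snd measurable_component_singleton[OF j]])
    show "(\<lambda>z. F (fst (snd z j))) \<in> borel_measurable (borel \<Otimes>\<^sub>M (\<Pi>\<^sub>M j\<in>{1..m}. borel \<Otimes>\<^sub>M borel))"
      "(\<lambda>z. G (snd (snd z j))) \<in> borel_measurable (borel \<Otimes>\<^sub>M (\<Pi>\<^sub>M j\<in>{1..m}. borel \<Otimes>\<^sub>M borel))"
      by measurable
  qed measurable
  define k where "k = (\<lambda>z y. g y * copula_cond_density c2 c3 m (\<tau> z) (G y))"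
  have k0: "0 \<le> k z y" for z y
    unfolding k_def by (intro mult_nonneg_nonneg g0 copula_cond_density_nonneg[OF c m])
  have k_m: "case_prod k \<in> borel_measurable (N \<Otimes>\<^sub>M borel)"
  proof -
    have km: "case_prod (copula_cond_density c2 c3 m) \<in> borel_measurable (N \<Otimes>\<^sub>M borel)"
      using measurable_copula_cond_density[OF c m] by (simp add: N')
    have "(\<lambda>p. (\<tau> (fst p), G (snd p))) \<in> measurable (N \<Otimes>\<^sub>M borel) (N \<Otimes>\<^sub>M borel)" by measurable
    from measurable_compose[OF this km]
    have [measurable]: "(\<lambda>p. copula_cond_density c2 c3 m (\<tau> (fst p)) (G (snd p))) \<in> borel_measurable (N \<Otimes>\<^sub>M borel)"
      by simp
    show ?thesis unfolding k_def case_prod_beta' by measurable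
  qed
  have joint: "(\<integral>\<^sup>+\<omega>. \<Theta> (Z \<omega>, Y n \<omega>) \<partial>M) = (\<integral>\<^sup>+\<omega>. \<integral>\<^sup>+y. \<Theta> (Z \<omega>, y) * ennreal (k (Z \<omega>) y) \<partial>lborel \<partial>M)"
    if "\<Theta> \<in> borel_measurable (N \<Otimes>\<^sub>M borel)" for \<Theta>
    using exch2_copula_model_joint_law[OF m model[unfolded nm] that[unfolded N']]
    by (simp only: Z' k_def \<tau>_def nm)
  let ?F = "vimage_algebra (space M) Z N"
  \<comment> \<open>Used for three choices of \<phi>: the constant 1 gives the normalisation,
    indicators give the conditional probabilities, and the identity gives the predictor.\<close>
  have ce: "AE \<omega> in M. integrable lborel (\<lambda>y. \<phi> y * k (Z \<omega>) y) \<and>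
      real_cond_exp M ?F (\<lambda>\<omega>. \<phi> (Y n \<omega>)) \<omega> = (LINT y|lborel. \<phi> y * k (Z \<omega>) y)"
    if "\<phi> \<in> borel_measurable borel" "integrable M (\<lambda>\<omega>. \<phi> (Y n \<omega>))" for \<phi>
    by (rule M.real_cond_exp_conditional_density[OF Z_m Y_m[OF nn] k_m k0 _ that]) (rule joint)
  \<comment> \<open>F(X_j) has law \<open>unif01\<close>, so a property of almost every u holds
    along X_j, and for the finitely many j together.\<close>
  have "AE \<omega> in M. \<forall>j\<in>{1..n}. cond_law_regular c2 (F (X j \<omega>))"
  proof (intro AE_ball_countable[THEN iffD2] ballI)
    fix j assume j: "j \<in> {1..n}"
    interpret L: atomless_real_distribution "distr M borel (X j)" by (rule LX[OF j])
    have "AE u in distr (distr M borel (X j)) borel F. cond_law_regular c2 u"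
      using AE_cond_law_regular[OF c(1)] unfolding L.distr_cdf[unfolded F[OF j]] .
    from AE_distrD[OF X_m[OF j] AE_distrD[OF _ this]] show "AE \<omega> in M. cond_law_regular c2 (F (X j \<omega>))"
      by simp
  qed simp
  then have reg: "AE \<omega> in M. cond_law_regular c2 (F (X n \<omega>)) \<and> gP (Z \<omega>) = k (Z \<omega>) \<and>
    eP (Z \<omega>) = (\<lambda>t. quantile G (quantile (cdf (cond_law c2 (F (X n \<omega>)))) t) *
      (c3 n ((copula_scores c2 m (snd (\<tau> (Z \<omega>))))(n := t)) / c3 m (copula_scores c2 m (snd (\<tau> (Z \<omega>))))))"
  proof eventually_elim
    case (elim \<omega>)
    let ?S = "copula_scores c2 m (snd (\<tau> (Z \<omega>)))"
    have r: "copula2_cond_cdf c2 v (F (X j \<omega>)) = cdf (cond_law c2 (F (X j \<omega>))) v" if "j \<in> {1..n}" for j v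
      using elim that by (auto simp: cond_law_regular_def)
    have S: "(\<lambda>j\<in>{1..m}. w (snd (Z \<omega>)) j) = ?S"
      unfolding copula_scores_def w Z' \<tau>_def using nm by (auto intro!: restrict_ext simp: r)
    have St: "(\<lambda>j\<in>{1..n}. if j < n then w (snd (Z \<omega>)) j else t) = ?S(n := t)" for t
      unfolding S[symmetric] nm by (auto simp: fun_eq_iff restrict_def)
    have fs: "fst (Z \<omega>) = X n \<omega>" by (simp add: Z)
    have "gP (Z \<omega>) y = k (Z \<omega>) y" for y
      unfolding gP case_prod_beta' k_def copula_cond_density_def n1 S St r[OF nn] fs
      by (simp add: \<tau>_def fs nm)
    moreover have "eP (Z \<omega>) = (\<lambda>t. quantile G (quantile (cdf (cond_law c2 (F (X n \<omega>)))) t) * (c3 n (?S(n := t)) / c3 m ?S))"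
      unfolding eP case_prod_beta' n1 S St fs r[OF nn] ..
    ultimately show ?case using elim nn by auto
  qed
  have k_s: "k (Z \<omega>) \<in> borel_measurable borel" if "\<omega> \<in> space M" for \<omega>
    using measurable_compose[OF measurable_Pair1'[OF measurable_space[OF Z_m that]] k_m] by simp
  have sub: "subalgebra M ?F"
    unfolding subalgebra_def using measurable_space[OF Z_m] Z_m by (auto simp: sets_vimage_algebra2)
  interpret finite_measure_subalgebra M ?F
    by unfold_locales (rule sub)
  \<comment> \<open>The total mass of k is read off from two evaluations of the conditional
    expectation of 1.\<close>
  have "AE \<omega> in M. real_cond_exp M ?F (\<lambda>_. 1) \<omega> = 1"
    by (rule real_cond_exp_F_meas) auto
  moreover have "AE \<omega> in M. integrable lborel (\<lambda>y. 1 * k (Z \<omega>) y) \<and>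
      real_cond_exp M ?F (\<lambda>_. 1) \<omega> = (LINT y|lborel. 1 * k (Z \<omega>) y)"
    by (rule ce) auto
  ultimately have one: "AE \<omega> in M. (\<integral>\<^sup>+y. ennreal (k (Z \<omega>) y) \<partial>lborel) = 1"
  proof eventually_elim
    case (elim \<omega>)
    then show ?case by (subst nn_integral_eq_integral) (auto simp: k0)
  qed
  have "conditional_density M N Z (Y n) gP"
    unfolding conditional_density_def
  proof (intro conjI ballI)
    show "AE \<omega> in M. gP (Z \<omega>) \<in> borel_measurable borel \<and> (\<forall>y. 0 \<le> gP (Z \<omega>) y) \<and> (\<integral>\<^sup>+y. ennreal (gP (Z \<omega>) y) \<partial>lborel) = 1"
      using reg one AE_space by eventually_elim (simp add: k_s k0)
    fix B :: "real set" assume B[measurable]: "B \<in> sets borel"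
    have "integrable M (\<lambda>\<omega>. indicator B (Y n \<omega>) :: real)"
      using Y_m[OF nn] by (intro M.integrable_const_bound[of _ 1]) (auto simp: indicator_def)
    from ce[OF borel_measurable_indicator[OF B] this] reg
    show "AE \<omega> in M. real_cond_exp M ?F (\<lambda>\<omega>. indicator B (Y n \<omega>)) \<omega> = (LINT y:B|lborel. gP (Z \<omega>) y)"
      by eventually_elim (simp add: set_lebesgue_integral_def)
  qed
  moreover have sub_eq: "AE \<omega> in M. integrable lborel (\<lambda>y. y * gP (Z \<omega>) y) = set_integrable lborel {0..1} (eP (Z \<omega>)) \<and>
            (LINT y|lborel. y * gP (Z \<omega>) y) = (LINT t:{0..1}|lborel. eP (Z \<omega>) t)"
    using reg
  proof eventually_elim
    case (elim \<omega>)
    let ?S = "copula_scores c2 m (snd (\<tau> (Z \<omega>)))"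
    have "(\<lambda>t. c3 (Suc m) (?S(Suc m := t))) \<in> borel_measurable borel"
      by (rule measurable_compose[OF measurable_fun_upd_Suc[OF measurable_const[OF space_copula_scores]] exchangeable_copula_family_measurable[OF c(2)]]) simp_all
    then have \<kappa>: "(\<lambda>t. c3 n (?S(n := t)) / c3 m ?S) \<in> borel_measurable borel"
      unfolding nm by measurable
    have k: "k (Z \<omega>) y = g y * c2 (F (X n \<omega>)) (G y) * (c3 n (?S(n := cdf (cond_law c2 (F (X n \<omega>))) (G y))) / c3 m ?S)" for y
      by (simp add: k_def copula_cond_density_def \<tau>_def Z nm)
    have reg\<omega>: "cond_law_regular c2 (F (X n \<omega>))" and gk: "gP (Z \<omega>) = k (Z \<omega>)" using elim by auto
    note sb = integrable_copula_substitution[OF c(1) reg\<omega> g_m g0 LY[unfolded LYd] G[OF nn, unfolded LYd, symmetric] \<kappa>]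
    show ?case
      unfolding gk conjunct2[OF conjunct2[OF elim]] using sb by (simp only: k simp_thms)
  qed
  moreover have "AE \<omega> in M. set_integrable lborel {0..1} (eP (Z \<omega>)) \<and>
      real_cond_exp M ?F (Y n) \<omega> = (LINT t:{0..1}|lborel. eP (Z \<omega>) t)" if "integrable M (Y n)"
    using ce[of "\<lambda>y. y", OF measurable_ident_sets[OF refl] that] reg sub_eq by eventually_elim simp
  ultimately show ?thesis by blast
qed

end
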